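(* In the multidimensional Siegmund problem described in the context, consider the two conditions $$(H1):\ \min_{k\ne k'\in[d]}\left(uz_k+s_{k,k'}\right)\ge\min_{k\in[d]}2r_{\{k\}},\qquad (H2):\ \min_{k\ne k'\in[d]}2s_{k,k'}\ge\min_{k\in[d]}2r_{\{k\}}.$$ Under either condition, $r_*=\min_{k\in[d]}r_{\{k\}}$. Further, define $\Theta^{(0)}=\{\beta^{\{k\}}:k\in[d]\}$ and $$\Theta^{(1)}=\Theta^{(0)}\cup\{\gamma^k:k\in[d]\},\qquad\Theta^{(2)}=\Theta^{(0)}\cup\{\gamma^{k,k'}:k\ne k'\in[d]\}.$$ If $(H1)$ holds, then $\mathbb{P}_{\Theta^{(1)}}$ is asymptotically efficient for estimating $\mathbb{P}(\tau_b^*<\tau_b^\emptyset)$. If $(H2)$ holds, then $\mathbb{P}_{\Theta^{(2)}}$ is asymptotically efficient for estimating $\mathbb{P}(\tau_b^*<\tau_b^\emptyset)$.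
   Context: $X_1,X_2,\ldots$ are i.i.d. $\mathbb{R}^d$-valued random vectors on $(\Omega,\mathcal{F},\mathbb{P})$ with $\mathbb{E}[X_{1,k}]<0$ for each coordinate $k\in[d]=\{1,\dots,d\}$; $S_0=0$, $S_n=\sum_{i\le n}X_i$, $\mathcal{F}_n=\sigma(X_1,\ldots,X_n)$. $\Lambda(\theta)=\log\mathbb{E}[e^{\theta\cdot X_1}]$, $\Lambda^*(x)=\sup_\theta\{\theta\cdot x-\Lambda(\theta)\}$, $I(x)=\sup\{\theta\cdot x:\Lambda(\theta)\le0\}$; $\operatorname{dom}(f)=\{f<\infty\}$, $\operatorname{cone}(A)=\{\lambda x:\lambda>0,x\in A\}$. Multidimensional Siegmund problem: fix $\ell,u>0$. For $A\subset[d]$, $$W^A=\{x\in\mathbb{R}^d:x_k>u\text{ for }k\in A,\ x_{k'}<-\ell\text{ for }k'\notin A\},$$ $\tau_b^A=\inf\{n\ge0:S_n\in bW^A\}$ ($b>0$, $\inf\emptyset=\infty$), and $\tau_b^*=\min\{\tau_b^A:\emptyset\ne A\subset[d]\}$. Standing assumption: $\operatorname{dom}(\Lambda)$ is open and $\operatorname{int}(\operatorname{cone}(\operatorname{dom}(\Lambda^* )))\cap W^A\neq\emptyset$ for every nonempty $A\subset[d]$. For nonempty $A$: $r_A=\inf_{x\in W^A}I(x)$, $r_*=\min_{\emptyset\ne A\subset[d]}r_A$, and $\beta^A$ is the unique vector with $\Lambda(\beta^A)=0$, $W^A\subset\{v:\beta^A\cdot v\ge r_A\}$, $\{x:I(x)\le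 r_A\}\subset\{v:\beta^A\cdot v\le r_A\}$ (existence and uniqueness are known). For $k\in[d]$, $z_k$ is the unique positive number with $\mathbb{E}[\exp(z_kX_{1,k})]=1$, and $\gamma^k\in\mathbb{R}^d$ has $k$-th coordinate $z_k$ and all other coordinates $0$ (it solves $\max u\theta_k$ subject to $\Lambda(\theta)\le0$, $\theta_k\ge0$, $\theta_{k'}=0$ for $k'\ne k$). For $m\ne m'\in[d]$, $s_{m,m'}$ and $\gamma^{m,m'}$ are the optimal value and maximizer of $$\max_{\theta\in\mathbb{R}^d}u(\theta_m+\theta_{m'})\ \text{ subject to }\ \Lambda(\theta)\le0,\ \theta_m\ge0,\ \theta_{m'}\ge0,\ \theta_k=0\text{ for }k\notin\{m,m'\}.$$ For $\theta\in\operatorname{dom}(\Lambda)$, $\mathbb{P}_\theta$ is the probability measure with $\frac{d\mathbb{P}_\theta}{d\mathbb{P}}(\mathcal{F}_n)=\exp(\theta\cdot S_n-n\Lambda(\theta))$ for all $n$. For finite nonempty $\Theta\subset\operatorname{dom}(\Lambda)$, $\mathbb{P}_\Theta=\frac1{|\Theta|}\sum_{\theta\in\Theta}\mathbb{P}_\theta$ (expectation $\mathbb{E}_\Theta$) and $$\widehat{\mathbb{W}}_b(\Theta)=\Big(\frac1{|\Theta|}\sum_{\theta\in\Theta}\exp(\theta\cdot S_{\tau_b^*}-\tau_b^*\Lambda(\theta))\Big)^{-1}\mathbf 1\{\tau_b^*<\tau_b^\emptyset\}.$$ $\mathbb{P}_\Theta$ is asymptotically efficient for estimating $\mathbb{P}(\tau_b^*<\tau_b^\emptyset)$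 if $\log\mathbb{E}_\Theta[(\widehat{\mathbb{W}}_b(\Theta))^2]\big/\big(2\log\mathbb{P}(\tau_b^*<\tau_b^\emptyset)\big)\to1$ as $b\to\infty$. *)

theory Defs
  imports "HOL-Probability.Probability"
begin

definition edom :: "('b \<Rightarrow> ereal) \<Rightarrow> 'b set" where
  "edom f = {x. f x < \<infinity>}"

text \<open>The scaling factors are strictly positive, unlike in the library's \<^const>\<open>cone\<close> and
  \<^const>\<open>hull\<close>, where 0 is allowed.\<close>
definition pos_cone :: "'b::real_vector set \<Rightarrow> 'b set" where
  "pos_cone A = {c *\<^sub>R x |c x. c > 0 \<and> x \<in> A}"

text \<open>The index set \<open>[d]\<close> is the finite type \<open>'d\<close>. Steps are numbered from 1; \<open>X 0\<close> plays no
  role.\<close>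
locale random_walk = prob_space M for M :: "'a measure" +
  fixes X :: "nat \<Rightarrow> 'a \<Rightarrow> real ^ 'd::finite"
  assumes indep: "indep_vars (\<lambda>_. borel) X {1..}"
    and identically_distributed: "\<And>i. i \<ge> 1 \<Longrightarrow> distr M borel (X i) = distr M borel (X 1)"
    and negative_drift: "\<And>k. integrable M (\<lambda>\<omega>. X 1 \<omega> $ k) \<and> expectation (\<lambda>\<omega>. X 1 \<omega> $ k) < 0"
begin

definition S :: "nat \<Rightarrow> 'a \<Rightarrow> real ^ 'd" where
  "S n \<omega> = (\<Sum>i=1..n. X i \<omega>)"

definition F :: "nat \<Rightarrow> 'a measure" where
  "F n = sigma (space M) (\<Union>i\<in>{1..n}. {X i -` B \<inter> space M |B. B \<in> sets borel})"

definition Lambda :: "real ^ 'd \<Rightarrow> ereal" where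
  "Lambda \<theta> = (if integrable M (\<lambda>\<omega>. exp (\<theta> \<bullet> X 1 \<omega>))
               then ereal (ln (expectation (\<lambda>\<omega>. exp (\<theta> \<bullet> X 1 \<omega>)))) else \<infinity>)"

definition Lambda_star :: "real ^ 'd \<Rightarrow> ereal" where
  "Lambda_star x = (SUP \<theta>. ereal (\<theta> \<bullet> x) - Lambda \<theta>)"

definition I :: "real ^ 'd \<Rightarrow> ereal" where
  "I x = (SUP \<theta>\<in>{\<theta>. Lambda \<theta> \<le> 0}. ereal (\<theta> \<bullet> x))"

text \<open>\<open>N\<close> is a version of the exponentially tilted measure \<open>P\<^sub>\<theta>\<close>. As \<open>P\<^sub>\<theta>\<close> need not exist on an
  arbitrary probability space, and the measure is determined by the condition only on the
  \<open>\<sigma>\<close>-algebra generated by the steps, this is a predicate.\<close>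
definition is_tilted :: "real ^ 'd \<Rightarrow> 'a measure \<Rightarrow> bool" where
  "is_tilted \<theta> N \<longleftrightarrow> prob_space N \<and> sets N = sets M \<and>
     (\<forall>n. restr_to_subalg N (F n) =
        density (restr_to_subalg M (F n))
          (\<lambda>\<omega>. ennreal (exp (\<theta> \<bullet> S n \<omega> - real n * real_of_ereal (Lambda \<theta>)))))"

definition mixture :: "(real ^ 'd \<Rightarrow> 'a measure) \<Rightarrow> (real ^ 'd) set \<Rightarrow> 'a measure" where
  "mixture Q \<Theta> = measure_of (space M) (sets M)
     (\<lambda>B. (\<Sum>\<theta>\<in>\<Theta>. emeasure (Q \<theta>) B) / of_nat (card \<Theta>))"

end

definition W :: "real \<Rightarrow> real \<Rightarrow> 'd::finite set \<Rightarrow> (real ^ 'd) set" where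
  "W l u A = {x. (\<forall>k\<in>A. x $ k > u) \<and> (\<forall>k\<in>-A. x $ k < - l)}"

locale siegmund = random_walk M X
  for M :: "'a measure" and X :: "nat \<Rightarrow> 'a \<Rightarrow> real ^ 'd::finite" +
  fixes l u :: real
  assumes l_pos: "l > 0" and u_pos: "u > 0"
    and open_dom: "open (edom Lambda)"
    and cone_meets_W: "\<And>A. A \<noteq> {} \<Longrightarrow> interior (pos_cone (edom Lambda_star)) \<inter> W l u A \<noteq> {}"
begin

text \<open>The infimum of the empty set in \<^typ>\<open>enat\<close> is \<open>\<infinity>\<close>.\<close>
definition tau :: "real \<Rightarrow> 'd set \<Rightarrow> 'a \<Rightarrow> enat" where
  "tau b A \<omega> = Inf {enat n |n. S n \<omega> \<in> (*\<^sub>R) b ` W l u A}"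

definition tau_star :: "real \<Rightarrow> 'a \<Rightarrow> enat" where
  "tau_star b \<omega> = (INF A\<in>{A. A \<noteq> {}}. tau b A \<omega>)"

definition r :: "'d set \<Rightarrow> ereal" where
  "r A = (INF x\<in>W l u A. I x)"

definition r_star :: ereal where
  "r_star = (INF A\<in>{A. A \<noteq> {}}. r A)"

definition is_beta :: "'d set \<Rightarrow> real ^ 'd \<Rightarrow> bool" where
  "is_beta A \<beta> \<longleftrightarrow> Lambda \<beta> = 0 \<and> W l u A \<subseteq> {v. ereal (\<beta> \<bullet> v) \<ge> r A} \<and>
     {x. I x \<le> r A} \<subseteq> {v. ereal (\<beta> \<bullet> v) \<le> r A}"

definition is_z :: "'d \<Rightarrow> real \<Rightarrow> bool" where
  "is_z k z \<longleftrightarrow> z > 0 \<and> integrable M (\<lambda>\<omega>. exp (z * X 1 \<omega> $ k)) \<and>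
     expectation (\<lambda>\<omega>. exp (z * X 1 \<omega> $ k)) = 1"

definition feasible :: "'d \<Rightarrow> 'd \<Rightarrow> (real ^ 'd) set" where
  "feasible m m' = {\<theta>. Lambda \<theta> \<le> 0 \<and> \<theta> $ m \<ge> 0 \<and> \<theta> $ m' \<ge> 0 \<and> (\<forall>k. k \<notin> {m, m'} \<longrightarrow> \<theta> $ k = 0)}"

definition s :: "'d \<Rightarrow> 'd \<Rightarrow> ereal" where
  "s m m' = (SUP \<theta>\<in>feasible m m'. ereal (u * (\<theta> $ m + \<theta> $ m')))"

definition is_gamma :: "'d \<Rightarrow> 'd \<Rightarrow> real ^ 'd \<Rightarrow> bool" where
  "is_gamma m m' \<gamma> \<longleftrightarrow> is_arg_max (\<lambda>\<theta>. u * (\<theta> $ m + \<theta> $ m')) (\<lambda>\<theta>. \<theta> \<in> feasible m m') \<gamma>"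

text \<open>For \<open>d = 1\<close> the minimum over \<open>k \<noteq> k'\<close> ranges over the empty set and is \<open>\<infinity>\<close>; all
  other minima are over nonempty finite sets.\<close>
definition H1 :: "('d \<Rightarrow> real) \<Rightarrow> bool" where
  "H1 z \<longleftrightarrow> (INF (k, k')\<in>{(k, k'). k \<noteq> k'}. ereal (u * z k) + s k k') \<ge> (INF k. 2 * r {k})"

definition H2 :: bool where
  "H2 \<longleftrightarrow> (INF (k, k')\<in>{(k, k'). k \<noteq> k'}. 2 * s k k') \<ge> (INF k. 2 * r {k})"

text \<open>On \<open>tau_star b \<omega> = \<infinity>\<close> the value of \<^const>\<open>the_enat\<close> is irrelevant, since the indicator
  vanishes there.\<close>
definition W_hat :: "real \<Rightarrow> (real ^ 'd) set \<Rightarrow> 'a \<Rightarrow> real" where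
  "W_hat b \<Theta> \<omega> =
     (let n = the_enat (tau_star b \<omega>) in
      inverse (1 / real (card \<Theta>) *
        (\<Sum>\<theta>\<in>\<Theta>. exp (\<theta> \<bullet> S n \<omega> - real n * real_of_ereal (Lambda \<theta>)))) *
      indicator {\<omega>. tau_star b \<omega> < tau b {} \<omega>} \<omega>)"

text \<open>Since the Bochner integral of a non-integrable function is 0, finiteness of the second moment
  (implied by the limit for large \<open>b\<close>) is explicit. As \<open>ln 0 = 0\<close> and \<open>x / 0 = 0\<close>, a ratio with a
  degenerate logarithm is 0 and cannot contribute to a limit of 1.\<close>
definition asymptotically_efficient ::
  "(real ^ 'd \<Rightarrow> 'a measure) \<Rightarrow> (real ^ 'd) set \<Rightarrow> bool" where
  "asymptotically_efficient Q \<Theta> \<longleftrightarrow>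
     (\<forall>\<^sub>F b in at_top. integrable (mixture Q \<Theta>) (\<lambda>\<omega>. (W_hat b \<Theta> \<omega>)\<^sup>2)) \<and>
     ((\<lambda>b. ln (integral\<^sup>L (mixture Q \<Theta>) (\<lambda>\<omega>. (W_hat b \<Theta> \<omega>)\<^sup>2)) /
           (2 * ln (prob {\<omega>\<in>space M. tau_star b \<omega> < tau b {} \<omega>}))) \<longlongrightarrow> 1) at_top"

end

end

theory Submission
  imports Defs
begin

text \<open>Put \<open>corner A = (u on A, -l off A)\<close>. A vector \<open>\<theta>\<close> with \<open>\<Lambda> \<theta> \<le> 0\<close> whose coordinate signs match
  \<open>W\<^sup>A\<close> satisfies \<open>\<theta> \<bullet> S \<ge> b (\<theta> \<bullet> corner A)\<close> when \<open>S\<close> lies in \<open>b W\<^sup>A\<close>. Under the mixture, one factor of the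
  squared weight is bounded pathwise by some such \<open>\<theta> \<in> \<Theta>\<close>; the other turns the mixture back into the
  original measure, where a second such vector \<open>\<eta>\<close> bounds the probability of leaving through \<open>b W\<^sup>A\<close>.
  So the second moment is \<open>O (exp (- 2 \<rho> b))\<close> as soon as every \<open>A\<close> admits a pair with
  \<open>(\<theta> + \<eta>) \<bullet> corner A \<ge> 2 \<rho>\<close>: for singletons take \<open>\<theta> = \<eta> = \<beta>\<close>, and for larger \<open>A\<close> (H1) and (H2) supply the
  pairs \<open>(\<gamma>\<^sup>k, \<gamma>\<^sup>k\<^sup>k\<^sup>')\<close> and \<open>(\<gamma>\<^sup>k\<^sup>k\<^sup>', \<gamma>\<^sup>k\<^sup>k\<^sup>')\<close>.

  By Jensen's inequality it remains to bound the probability from below by \<open>exp (- (\<rho> + o(1)) b)\<close>. The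
  optimality conditions for \<open>\<beta>\<close> say that under the \<open>\<beta>\<close>-tilted law the walk drifts towards the optimal point
  of the closure of \<open>W\<^sup>A\<close>, hence with high probability it enters \<open>b W\<^sup>A\<close> slightly after the optimal time without
  visiting \<open>b W\<^sup>\<emptyset>\<close>, and undoing the tilt costs \<open>exp (- \<beta> \<bullet> S)\<close>.\<close>

section \<open>Tilted measures and the moment generating function\<close>

text \<open>An \<open>F\<close>-measurable integrand sees only the restrictions of the measures to
  \<open>F\<close>, so a density known on \<open>F\<close> alone suffices to change the measure.
  This serves both for a single tilt and for the mixture.\<close>

lemma nn_integral_density_restr:
  assumes M: "subalgebra M F" and N: "subalgebra N F"
    and dens: "restr_to_subalg N F = density (restr_to_subalg M F) g"
    and g: "g \<in> borel_measurable F" and f: "f \<in> borel_measurable F"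
  shows "(\<integral>\<^sup>+x. f x \<partial>N) = (\<integral>\<^sup>+x. g x * f x \<partial>M)"
proof -
  have "(\<integral>\<^sup>+x. f x \<partial>N) = (\<integral>\<^sup>+x. f x \<partial>density (restr_to_subalg M F) g)"
    using nn_integral_subalgebra2[OF N f] dens by simp
  also have "\<dots> = (\<integral>\<^sup>+x. g x * f x \<partial>restr_to_subalg M F)"
    by (intro nn_integral_density measurable_in_subalg M f g)
  also have "\<dots> = (\<integral>\<^sup>+x. g x * f x \<partial>M)"
    by (intro nn_integral_subalgebra2[OF M]) (use f g in measurable)
  finally show ?thesis .
qed

context random_walk
begin

text \<open>The real number \<open>exp (Lambda \<theta>)\<close> for \<theta> in
  \<open>edom Lambda\<close>. Outside the domain the Bochner integral takes the default value 0, so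
  domain membership has to be carried along with every bound on \<open>mgf\<close>.\<close>

definition mgf :: "real ^ 'd \<Rightarrow> real" where
  "mgf \<theta> = expectation (\<lambda>\<omega>. exp (\<theta> \<bullet> X 1 \<omega>))"

lemma X_measurable: "i \<ge> 1 \<Longrightarrow> X i \<in> borel_measurable M"
  using indep by (auto simp: indep_vars_def2)

lemma space_F [simp]: "space (F n) = space M"
  by (simp add: F_def space_measure_of_conv)

lemma subalgebra_F: "subalgebra M (F n)"
proof -
  have "(\<Union>i\<in>{1..n}. {X i -` B \<inter> space M |B. B \<in> sets borel}) \<subseteq> sets M"
    using X_measurable by (fastforce intro: measurable_sets)
  then show ?thesis
    unfolding subalgebra_def F_def
    by (simp add: space_measure_of_conv sets_measure_of_conv sets.sigma_sets_subset)
qed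

lemma X_measurable_F:
  assumes "i \<in> {1..n}"
  shows "X i \<in> borel_measurable (F n)"
proof (rule measurableI)
  fix B :: "(real ^ 'd) set" assume "B \<in> sets borel"
  then have "X i -` B \<inter> space M \<in> (\<Union>i\<in>{1..n}. {X i -` B \<inter> space M |B. B \<in> sets borel})"
    using assms by blast
  then show "X i -` B \<inter> space (F n) \<in> sets (F n)"
    unfolding space_F unfolding F_def by (subst sets_measure_of) (auto intro: sigma_sets.Basic)
qed simp

lemma S_measurable_F: "j \<le> n \<Longrightarrow> S j \<in> borel_measurable (F n)"
  unfolding S_def by (intro borel_measurable_sum X_measurable_F) auto

lemma S_measurable: "S j \<in> borel_measurable M"
  using measurable_from_subalg[OF subalgebra_F S_measurable_F[OF order_refl]] .

lemma edom_iff: "\<theta> \<in> edom Lambda \<longleftrightarrow> integrable M (\<lambda>\<omega>. exp (\<theta> \<bullet> X 1 \<omega>))"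
  by (auto simp: edom_def Lambda_def)

lemma mgf_pos: "\<theta> \<in> edom Lambda \<Longrightarrow> mgf \<theta> > 0"
  using integral_less_AE_space[of "\<lambda>_. 0" "\<lambda>\<omega>. exp (\<theta> \<bullet> X 1 \<omega>)"]
  by (auto simp: mgf_def edom_iff emeasure_space_1)

lemma Lambda_eq: "\<theta> \<in> edom Lambda \<Longrightarrow> Lambda \<theta> = ereal (ln (mgf \<theta>))"
  by (simp add: edom_iff Lambda_def mgf_def)

lemma Lambda_le_0_iff: "Lambda \<theta> \<le> 0 \<longleftrightarrow> \<theta> \<in> edom Lambda \<and> mgf \<theta> \<le> 1"
proof (cases "\<theta> \<in> edom Lambda")
  case True
  then show ?thesis using mgf_pos[OF True] by (simp add: Lambda_eq)
qed (auto simp: edom_def)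

lemma Lambda_eq_0_iff: "Lambda \<theta> = 0 \<longleftrightarrow> \<theta> \<in> edom Lambda \<and> mgf \<theta> = 1"
proof (cases "\<theta> \<in> edom Lambda")
  case True
  then show ?thesis using mgf_pos[OF True] by (simp add: Lambda_eq zero_ereal_def)
qed (auto simp: edom_def)

lemma zero_in_edom: "0 \<in> edom Lambda" and mgf_zero: "mgf 0 = 1"
  by (simp_all add: edom_iff mgf_def prob_space)

section \<open>Exponential moments of the walk and change of measure on \<open>F n\<close>\<close>

lemma nn_integral_exp_S:
  assumes "\<theta> \<in> edom Lambda"
  shows "(\<integral>\<^sup>+\<omega>. ennreal (exp (\<theta> \<bullet> S n \<omega>)) \<partial>M) = ennreal (mgf \<theta> ^ n)"
proof -
  have dist: "(\<integral>\<^sup>+\<omega>. ennreal (exp (\<theta> \<bullet> X i \<omega>)) \<partial>M) = ennreal (mgf \<theta>)" if "i \<ge> 1" for i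
  proof -
    have "(\<integral>\<^sup>+\<omega>. ennreal (exp (\<theta> \<bullet> X i \<omega>)) \<partial>M)
        = (\<integral>\<^sup>+x. ennreal (exp (\<theta> \<bullet> x)) \<partial>distr M borel (X i))"
      by (subst nn_integral_distr) (auto intro: X_measurable that)
    also have "\<dots> = (\<integral>\<^sup>+x. ennreal (exp (\<theta> \<bullet> x)) \<partial>distr M borel (X 1))"
      using identically_distributed[OF that] by simp
    also have "\<dots> = (\<integral>\<^sup>+\<omega>. ennreal (exp (\<theta> \<bullet> X 1 \<omega>)) \<partial>M)"
      by (subst nn_integral_distr) (auto intro: X_measurable)
    also have "\<dots> = ennreal (mgf \<theta>)"
      unfolding mgf_def using assms by (intro nn_integral_eq_integral) (auto simp: edom_iff)
    finally show ?thesis .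
  qed
  have "indep_vars (\<lambda>_. borel) (\<lambda>i \<omega>. ennreal (exp (\<theta> \<bullet> X i \<omega>))) {1..n}"
    by (rule indep_vars_compose2[OF indep_vars_subset[OF indep], where Y="\<lambda>_ x. ennreal (exp (\<theta> \<bullet> x))"])
      auto
  then have "(\<integral>\<^sup>+\<omega>. (\<Prod>i=1..n. ennreal (exp (\<theta> \<bullet> X i \<omega>))) \<partial>M) = (\<Prod>i=1..n. ennreal (mgf \<theta>))"
    by (subst indep_vars_nn_integral) (auto simp: dist)
  moreover have "(\<Prod>i=1..n. ennreal (exp (\<theta> \<bullet> X i \<omega>))) = ennreal (exp (\<theta> \<bullet> S n \<omega>))" for \<omega>
    by (simp add: S_def inner_sum_right exp_sum prod_ennreal)
  ultimately show ?thesis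
    using mgf_pos[OF assms] by (simp add: ennreal_power)
qed

lemma measurable_exp_tilt [measurable]:
  "(\<lambda>\<omega>. ennreal (exp (\<theta> \<bullet> S n \<omega> - c))) \<in> borel_measurable (F n)"
  using S_measurable_F[OF order_refl] by measurable

lemma tilted_subalgebra:
  assumes "is_tilted \<theta> N"
  shows "subalgebra N (F n)"
  using assms subalgebra_F[of n] sets_eq_imp_space_eq[of N M]
  by (auto simp: is_tilted_def subalgebra_def)

lemma nn_integral_tilted:
  assumes "is_tilted \<theta> N" and f: "f \<in> borel_measurable (F n)"
  shows "(\<integral>\<^sup>+\<omega>. f \<omega> \<partial>N) =
    (\<integral>\<^sup>+\<omega>. ennreal (exp (\<theta> \<bullet> S n \<omega> - real n * real_of_ereal (Lambda \<theta>))) * f \<omega> \<partial>M)"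
  using assms measurable_exp_tilt
  by (intro nn_integral_density_restr[OF subalgebra_F tilted_subalgebra]) (auto simp: is_tilted_def)

text \<open>The integral is the derivative at \<open>t = 0\<close> of
  \<open>exp (c * t) * mgf (\<beta> + t *\<^sub>R h)\<close>; if it is negative, the function drops
  below its value at 0 for small \<open>t\<close>. Openness of the domain provides exponential
  moments on both sides of 0 and thus a dominating function. The points \<open>1 / Suc n\<close> are
  used because dominated convergence is applied to sequences. Directions of feasibility need
  \<open>c = 0\<close>; the Chernoff bounds need general \<open>c\<close>.\<close>

lemma descent_direction:
  assumes "open (edom Lambda)" and \<beta>: "\<beta> \<in> edom Lambda"
  shows "integrable M (\<lambda>\<omega>. exp (\<beta> \<bullet> X 1 \<omega>) * (h \<bullet> X 1 \<omega> + c))"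
    and "expectation (\<lambda>\<omega>. exp (\<beta> \<bullet> X 1 \<omega>) * (h \<bullet> X 1 \<omega> + c)) < 0 \<Longrightarrow>
      \<forall>\<^sub>F n in sequentially. \<beta> + (1 / Suc n) *\<^sub>R h \<in> edom Lambda \<and>
        exp (c / Suc n) * mgf (\<beta> + (1 / Suc n) *\<^sub>R h) < mgf \<beta>"
proof -
  define Z where "Z \<omega> = h \<bullet> X 1 \<omega>" for \<omega>
  define w where "w \<omega> = exp (\<beta> \<bullet> X 1 \<omega>)" for \<omega>
  have meas [measurable]: "X 1 \<in> borel_measurable M" "Z \<in> borel_measurable M" "w \<in> borel_measurable M"
    using X_measurable[of 1] by (auto simp: Z_def[abs_def] w_def[abs_def])
  have w_pos: "w \<omega> > 0" for \<omega> by (simp add: w_def)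
  have "((\<lambda>t. \<beta> + t *\<^sub>R h) \<longlongrightarrow> \<beta> + 0 *\<^sub>R h) (nhds 0)"
    by (intro tendsto_intros) (simp add: filterlim_ident)
  then have "\<forall>\<^sub>F t in nhds 0. \<beta> + t *\<^sub>R h \<in> edom Lambda"
    using topological_tendstoD assms by fastforce
  then obtain e where e: "e > 0" "\<And>t. \<bar>t\<bar> < e \<Longrightarrow> \<beta> + t *\<^sub>R h \<in> edom Lambda"
    by (auto simp: eventually_nhds_metric dist_real_def)
  have int: "integrable M (\<lambda>\<omega>. w \<omega> * exp (t * Z \<omega>))" if "\<bar>t\<bar> < e" for t
    using e(2)[OF that] by (simp add: edom_iff w_def Z_def inner_add_left exp_add)
  \<comment> \<open>Staying strictly inside the interval makes both exponentials with parameters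
    \<open>t0\<close> and \<open>- t0\<close> integrable against \<open>w\<close>.\<close>
  define t0 where "t0 = e / 2"
  have t0: "t0 > 0" "\<bar>t0\<bar> < e" "\<bar>- t0\<bar> < e" using e(1) by (auto simp: t0_def)
  have intw: "integrable M w" using int[of 0] e(1) by simp
  have intY: "integrable M (\<lambda>\<omega>. w \<omega> * (Z \<omega> + c))"
  proof -
    have "integrable M (\<lambda>\<omega>. w \<omega> * Z \<omega>)"
    proof (rule Bochner_Integration.integrable_bound)
      show "integrable M (\<lambda>\<omega>. (w \<omega> * exp (t0 * Z \<omega>) + w \<omega> * exp (- t0 * Z \<omega>)) / t0)"
        using int[OF t0(2)] int[OF t0(3)] by auto
      \<comment> \<open>The inequality \<open>1 + y \<le> exp y\<close> at
        \<open>y = t0 * Z \<omega>\<close> and at its negative bounds the linear term by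
        exponentials.\<close>
      have "\<bar>Z \<omega>\<bar> \<le> (exp (t0 * Z \<omega>) + exp (- t0 * Z \<omega>)) / t0" for \<omega>
      proof -
        have "t0 * Z \<omega> \<le> exp (t0 * Z \<omega>)" "- t0 * Z \<omega> \<le> exp (- t0 * Z \<omega>)"
          using exp_ge_add_one_self[of "t0 * Z \<omega>"] exp_ge_add_one_self[of "- t0 * Z \<omega>"] by linarith+
        moreover have "exp (t0 * Z \<omega>) > 0" "exp (- t0 * Z \<omega>) > 0" by simp_all
        ultimately have "\<bar>t0 * Z \<omega>\<bar> \<le> exp (t0 * Z \<omega>) + exp (- t0 * Z \<omega>)"
          by linarith
        then have "t0 * \<bar>Z \<omega>\<bar> \<le> exp (t0 * Z \<omega>) + exp (- t0 * Z \<omega>)"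
          using t0(1) by (simp add: abs_mult)
        then show ?thesis using t0(1) by (simp add: field_simps)
      qed
      then have "w \<omega> * \<bar>Z \<omega>\<bar> \<le> w \<omega> * ((exp (t0 * Z \<omega>) + exp (- t0 * Z \<omega>)) / t0)" for \<omega>
        using w_pos[of \<omega>] by (intro mult_left_mono) auto
      then show "AE \<omega> in M. norm (w \<omega> * Z \<omega>)
          \<le> norm ((w \<omega> * exp (t0 * Z \<omega>) + w \<omega> * exp (- t0 * Z \<omega>)) / t0)"
        using w_pos t0(1) by (auto simp: abs_mult abs_of_pos distrib_left add_pos_pos)
    qed measurable
    then show ?thesis using intw by (auto simp: distrib_left)
  qed
  then show "integrable M (\<lambda>\<omega>. exp (\<beta> \<bullet> X 1 \<omega>) * (h \<bullet> X 1 \<omega> + c))"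
    by (simp add: w_def Z_def)
  define t where "t n = 1 / real (Suc n)" for n
  have t_pos: "t n > 0" for n by (simp add: t_def)
  have t_lim: "t \<longlonglongrightarrow> 0"
    unfolding t_def using LIMSEQ_inverse_real_of_nat by (simp add: inverse_eq_divide)
  \<comment> \<open>The dominating function below controls difference quotients only for steps up to
    \<open>t0\<close>, so the sequence is shifted by \<open>m\<close> and the shift is removed at
    the end.\<close>
  obtain m where "\<And>n. n \<ge> m \<Longrightarrow> t n < t0"
    using order_tendstoD(2)[OF t_lim t0(1)] by (auto simp: eventually_sequentially)
  then have m: "t (n + m) \<le> t0" for n by (simp add: less_imp_le)
  assume "expectation (\<lambda>\<omega>. exp (\<beta> \<bullet> X 1 \<omega>) * (h \<bullet> X 1 \<omega> + c)) < 0"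
  then have neg: "expectation (\<lambda>\<omega>. w \<omega> * (Z \<omega> + c)) < 0" by (simp add: w_def Z_def)
  \<comment> \<open>The difference quotient of \<open>exp (t * (Z \<omega> + c))\<close> at 0,
    weighted by the tilt.\<close>
  define f where "f n \<omega> = w \<omega> * ((exp (t n * (Z \<omega> + c)) - 1) / t n)" for n \<omega>
  have "(\<lambda>n. expectation (f (n + m))) \<longlonglongrightarrow> expectation (\<lambda>\<omega>. w \<omega> * (Z \<omega> + c))"
  proof (rule integral_dominated_convergence)
    let ?g = "\<lambda>\<omega>. \<bar>w \<omega> * (Z \<omega> + c)\<bar> + (exp (t0 * c) * (w \<omega> * exp (t0 * Z \<omega>)) + w \<omega>) / t0"
    show "integrable M ?g"
      using intY intw int[OF t0(2)] by auto
    fix n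
    have "norm (f (n + m) \<omega>) \<le> ?g \<omega>" for \<omega>
    proof -
      define s where "s = t (n + m)"
      define y where "y = Z \<omega> + c"
      have s: "0 < s" "s \<le> t0" using m[of n] t_pos by (auto simp: s_def)
      \<comment> \<open>Convexity of \<open>exp\<close> makes the secant slope from 0 increase with
        the step, so the slope at \<open>t0\<close> is an upper bound; the tangent at 0 gives the
        lower bound.\<close>
      have "exp ((1 - s / t0) *\<^sub>R 0 + (s / t0) *\<^sub>R (t0 * y)) \<le> (1 - s / t0) * exp 0 + (s / t0) * exp (t0 * y)"
        using s by (intro convex_onD[OF exp_convex]) auto
      then have "exp (s * y) - 1 \<le> s * ((exp (t0 * y) - 1) / t0)"
        using t0(1) by (simp add: algebra_simps diff_divide_distrib)
      then have "(exp (s * y) - 1) / s \<le> (exp (t0 * y) - 1) / t0"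
        using s by (simp add: pos_divide_le_eq mult.commute)
      moreover have "y \<le> (exp (s * y) - 1) / s"
        using exp_ge_add_one_self[of "s * y"] s by (simp add: field_simps)
      moreover have "(exp (t0 * y) - 1) / t0 \<le> (exp (t0 * y) + 1) / t0" "0 \<le> (exp (t0 * y) + 1) / t0"
        using t0(1) by (auto simp: divide_right_mono add_nonneg_nonneg)
      ultimately have "\<bar>(exp (s * y) - 1) / s\<bar> \<le> \<bar>y\<bar> + (exp (t0 * y) + 1) / t0" by linarith
      then have "w \<omega> * \<bar>(exp (s * y) - 1) / s\<bar> \<le> w \<omega> * (\<bar>y\<bar> + (exp (t0 * y) + 1) / t0)"
        using w_pos[of \<omega>] by (intro mult_left_mono) auto
      moreover have "norm (f (n + m) \<omega>) = w \<omega> * \<bar>(exp (s * y) - 1) / s\<bar>"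
        using w_pos[of \<omega>] by (simp add: f_def s_def y_def abs_mult)
      moreover have "\<bar>w \<omega> * (Z \<omega> + c)\<bar> = w \<omega> * \<bar>y\<bar>"
        using w_pos[of \<omega>] by (simp add: y_def abs_mult)
      then have "w \<omega> * (\<bar>y\<bar> + (exp (t0 * y) + 1) / t0) = ?g \<omega>"
        by (simp add: y_def distrib_left exp_add add_divide_distrib mult_ac)
      ultimately show ?thesis by simp
    qed
    then show "AE \<omega> in M. norm (f (n + m) \<omega>) \<le> ?g \<omega>" by simp
  next
    have "(\<lambda>n. f (n + m) \<omega>) \<longlonglongrightarrow> w \<omega> * (Z \<omega> + c)" for \<omega>
    proof -
      have "((\<lambda>s. exp (s * (Z \<omega> + c))) has_field_derivative (Z \<omega> + c)) (at 0)"
        by (auto intro!: derivative_eq_intros)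
      then have "((\<lambda>s. (exp (s * (Z \<omega> + c)) - 1) / s) \<longlongrightarrow> Z \<omega> + c) (at 0)"
        by (simp add: has_field_derivative_iff)
      moreover have "filterlim t (at 0) sequentially"
        using t_lim t_pos by (auto simp: filterlim_at less_imp_neq[symmetric])
      ultimately have "(\<lambda>n. (exp (t n * (Z \<omega> + c)) - 1) / t n) \<longlonglongrightarrow> Z \<omega> + c"
        by (rule filterlim_compose)
      then have "(\<lambda>n. f n \<omega>) \<longlonglongrightarrow> w \<omega> * (Z \<omega> + c)"
        unfolding f_def by (intro tendsto_mult tendsto_const)
      then show ?thesis by (rule LIMSEQ_ignore_initial_segment)
    qed
    then show "AE \<omega> in M. (\<lambda>n. f (n + m) \<omega>) \<longlonglongrightarrow> w \<omega> * (Z \<omega> + c)" by simp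
  qed (auto simp: f_def[abs_def])
  then have "(\<lambda>n. expectation (f n)) \<longlonglongrightarrow> expectation (\<lambda>\<omega>. w \<omega> * (Z \<omega> + c))"
    by (rule LIMSEQ_offset)
  then have "\<forall>\<^sub>F n in sequentially. expectation (f n) < 0"
    using neg by (rule order_tendstoD(2))
  moreover have "\<forall>\<^sub>F n in sequentially. t n < e"
    using t_lim e(1) by (rule order_tendstoD(2))
  ultimately show "\<forall>\<^sub>F n in sequentially. \<beta> + (1 / Suc n) *\<^sub>R h \<in> edom Lambda \<and>
      exp (c / Suc n) * mgf (\<beta> + (1 / Suc n) *\<^sub>R h) < mgf \<beta>"
  proof eventually_elim
    case (elim n)
    have int_n: "integrable M (\<lambda>\<omega>. w \<omega> * exp (t n * Z \<omega>))"
      using elim(2) t_pos[of n] by (intro int) auto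
    have "f n \<omega> = (exp (c * t n) * (w \<omega> * exp (t n * Z \<omega>)) - w \<omega>) / t n" for \<omega>
      by (simp add: f_def distrib_left exp_add algebra_simps)
    then have "expectation (f n)
        = (exp (c * t n) * expectation (\<lambda>\<omega>. w \<omega> * exp (t n * Z \<omega>)) - expectation w) / t n"
      using int_n intw by (simp cong: Bochner_Integration.integral_cong)
    moreover have "expectation (\<lambda>\<omega>. w \<omega> * exp (t n * Z \<omega>)) = mgf (\<beta> + t n *\<^sub>R h)"
      by (simp add: mgf_def w_def Z_def inner_add_left exp_add)
    moreover have "expectation w = mgf \<beta>" by (simp add: mgf_def w_def[abs_def])
    ultimately have "exp (c * t n) * mgf (\<beta> + t n *\<^sub>R h) < mgf \<beta>"
      using elim(1) t_pos[of n] by (simp add: divide_less_0_iff)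
    moreover have "\<beta> + t n *\<^sub>R h \<in> edom Lambda"
      using elim(2) t_pos[of n] by (intro e(2)) auto
    ultimately show ?case by (simp add: t_def)
  qed
qed

end

section \<open>Optimality conditions for \<open>\<beta>\<close>\<close>

text \<open>The first bound is the limit \<open>t \<longlonglongrightarrow> 0\<close>; the second
  holds because a negative slope would violate the hypothesis for large \<open>t\<close>.\<close>

lemma affine_lower_bound:
  fixes a c \<rho> :: real
  assumes "\<And>t. t > 0 \<Longrightarrow> \<rho> \<le> a + t * c"
  shows "\<rho> \<le> a" and "0 \<le> c"
proof -
  have "((\<lambda>t. a + t * c) \<longlongrightarrow> a + 0 * c) (at_right 0)"
    by (intro tendsto_intros)
  then show "\<rho> \<le> a"
    using assms by (intro tendsto_lowerbound[where F="at_right 0"]) (auto simp: eventually_at_right_less eventually_at_filter)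
  show "0 \<le> c"
  proof (rule ccontr)
    assume c: "\<not> 0 \<le> c"
    \<comment> \<open>With this \<open>t\<close> the right-hand side equals
      \<open>a - \<bar>a - \<rho>\<bar> - 1\<close>, which is below \<rho>.\<close>
    have "\<rho> \<le> a + (\<bar>a - \<rho>\<bar> + 1) / (- c) * c"
      using c by (intro assms divide_pos_pos) auto
    then show False using c by auto
  qed
qed

lemma axis_scale: "c *\<^sub>R axis k x = axis k (c *\<^sub>R x)"
  by (simp add: vec_eq_iff axis_def)

lemma axis_nth_if: "axis k x $ i = (if i = k then x else 0)"
  by (simp add: axis_def)

context random_walk
begin

text \<open>The gradient of \<open>mgf\<close> on its open domain. No normalization is included: it
  is the mean step under the tilted law when \<open>mgf \<theta> = 1\<close>, as is the case for the
  vectors \<beta>.\<close>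

definition tilted_mean :: "real ^ 'd \<Rightarrow> real ^ 'd" where
  "tilted_mean \<theta> = (\<chi> i. expectation (\<lambda>\<omega>. exp (\<theta> \<bullet> X 1 \<omega>) * X 1 \<omega> $ i))"

lemma expectation_tilted_affine:
  assumes "open (edom Lambda)" "\<theta> \<in> edom Lambda"
  shows "expectation (\<lambda>\<omega>. exp (\<theta> \<bullet> X 1 \<omega>) * (h \<bullet> X 1 \<omega> + c)) = h \<bullet> tilted_mean \<theta> + c * mgf \<theta>"
proof -
  have "integrable M (\<lambda>\<omega>. exp (\<theta> \<bullet> X 1 \<omega>) * X 1 \<omega> $ i)" for i
    using descent_direction(1)[OF assms, of "axis i 1" 0] by (simp add: inner_axis')
  moreover have "integrable M (\<lambda>\<omega>. exp (\<theta> \<bullet> X 1 \<omega>))"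
    using assms(2) by (simp add: edom_iff)
  moreover have "exp (\<theta> \<bullet> X 1 \<omega>) * (h \<bullet> X 1 \<omega> + c)
      = (\<Sum>i\<in>UNIV. h $ i * (exp (\<theta> \<bullet> X 1 \<omega>) * X 1 \<omega> $ i)) + c * exp (\<theta> \<bullet> X 1 \<omega>)" for \<omega>
    by (simp add: inner_vec_def[of h] distrib_left sum_distrib_left mult_ac)
  ultimately show ?thesis
    by (simp add: mgf_def tilted_mean_def inner_vec_def[of h])
qed

end

section \<open>The orthants \<open>W l u A\<close>, weak duality and the Karush--Kuhn--Tucker
  conditions\<close>

context siegmund
begin

text \<open>The vertex of the closure of the orthant \<open>W l u A\<close>.\<close>

definition corner :: "'d set \<Rightarrow> real ^ 'd" where
  "corner A = (\<chi> k. if k \<in> A then u else - l)"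

text \<open>The sign pattern of the orthant. The condition
  \<open>orient A k * \<theta> $ k \<ge> 0\<close> for all \<open>k\<close> says that \<theta> lies
  in the dual cone of its recession cone, and multiplying by \<open>orient\<close> turns upper and
  lower barriers into the same inequality.\<close>

definition orient :: "'d set \<Rightarrow> 'd \<Rightarrow> real" where
  "orient A k = (if k \<in> A then 1 else - 1)"

lemma orient_simps [simp]: "orient A k * orient A k = 1" "orient A k * (orient A k * x) = x" "orient A k \<noteq> 0"
  by (auto simp: orient_def)

lemma orient_corner_pos: "orient A k * corner A $ k > 0"
  using l_pos u_pos by (simp add: orient_def corner_def)

lemma W_iff: "x \<in> W l u A \<longleftrightarrow> (\<forall>k. orient A k * corner A $ k < orient A k * x $ k)"
  by (auto simp: W_def corner_def orient_def minus_less_iff less_minus_iff)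

lemma scaled_W_iff:
  assumes "b > 0"
  shows "x \<in> (*\<^sub>R) b ` W l u A \<longleftrightarrow> (\<forall>k. b * (orient A k * corner A $ k) < orient A k * x $ k)"
proof -
  have "x \<in> (*\<^sub>R) b ` W l u A \<longleftrightarrow> (1 / b) *\<^sub>R x \<in> W l u A"
    using assms by (auto intro!: image_eqI[of _ _ "(1 / b) *\<^sub>R x"])
  then show ?thesis using assms by (simp add: W_iff field_simps)
qed

text \<open>A linear functional from the dual cone is minimal on the closed orthant at the vertex;
  coordinatewise this is multiplication by a nonnegative number.\<close>

lemma inner_corner_le:
  assumes sgn: "\<And>k. orient A k * \<theta> $ k \<ge> 0" and x: "\<And>k. b * (orient A k * corner A $ k) \<le> orient A k * x $ k"
  shows "b * (\<theta> \<bullet> corner A) \<le> \<theta> \<bullet> x"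
proof -
  have "b * (\<theta> $ k * corner A $ k) \<le> \<theta> $ k * x $ k" for k
    using mult_left_mono[OF x[of k] sgn[of k]] by (auto simp: orient_def mult_ac split: if_splits)
  then show ?thesis
    by (simp add: inner_vec_def sum_distrib_left sum_mono)
qed

lemma inner_corner_le_scaled_W:
  assumes "b > 0" "\<And>k. orient A k * \<theta> $ k \<ge> 0" "x \<in> (*\<^sub>R) b ` W l u A"
  shows "b * (\<theta> \<bullet> corner A) \<le> \<theta> \<bullet> x"
  using assms scaled_W_iff by (intro inner_corner_le) (auto intro: less_imp_le)

text \<open>Weak duality: \<theta> is one of the functionals in the supremum defining
  \<open>I\<close>, and on the orthant it is at least its value at the vertex.\<close>

lemma inner_corner_le_r:
  assumes "Lambda \<theta> \<le> 0" "\<And>k. orient A k * \<theta> $ k \<ge> 0"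
  shows "ereal (\<theta> \<bullet> corner A) \<le> r A"
  unfolding r_def
proof (rule INF_greatest)
  fix x assume "x \<in> W l u A"
  then have "1 * (\<theta> \<bullet> corner A) \<le> \<theta> \<bullet> x"
    using assms(2) by (intro inner_corner_le) (auto simp: W_iff intro: less_imp_le)
  also have "ereal (\<theta> \<bullet> x) \<le> I x"
    unfolding I_def using assms(1) by (intro SUP_upper) auto
  finally show "ereal (\<theta> \<bullet> corner A) \<le> I x" by simp
qed

text \<open>A half-space containing the orthant has its normal in the dual cone, seen by moving to
  infinity along the axes. Letting points of the orthant approach the vertex gives
  \<open>r A \<le> \<beta> \<bullet> corner A\<close>, and weak duality gives the converse.\<close>

lemma beta_properties:
  assumes "is_beta A \<beta>"
  shows "\<beta> \<in> edom Lambda" "mgf \<beta> = 1" "orient A k * \<beta> $ k \<ge> 0" "r A = ereal (\<beta> \<bullet> corner A)"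
proof -
  have L: "Lambda \<beta> = 0" and half: "\<And>x. x \<in> W l u A \<Longrightarrow> r A \<le> ereal (\<beta> \<bullet> x)"
    using assms by (auto simp: is_beta_def)
  show "\<beta> \<in> edom Lambda" "mgf \<beta> = 1" using L by (auto simp: Lambda_eq_0_iff)
  \<comment> \<open>The orthant is open and misses its vertex; the inward diagonal
    \<open>one\<close> leads from the vertex into it.\<close>
  define one where "one = (\<chi> k. orient A k)"
  have W1: "corner A + one \<in> W l u A"
    by (simp add: W_iff one_def distrib_left)
  have "0 \<le> r A"
    using inner_corner_le_r[of 0 A] by (simp add: zero_ereal_def[symmetric] Lambda_le_0_iff zero_in_edom mgf_zero)
  then obtain \<rho> where \<rho>: "r A = ereal \<rho>"
    using half[OF W1] by (cases "r A") auto
  have sgn: "orient A k * \<beta> $ k \<ge> 0" for k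
  proof (rule affine_lower_bound(2))
    fix t :: real assume "t > 0"
    then have "corner A + one + t *\<^sub>R axis k (orient A k) \<in> W l u A"
      by (auto simp: W_iff one_def distrib_left axis_def mult.left_commute[of _ t])
    then show "\<rho> \<le> \<beta> \<bullet> (corner A + one) + t * (orient A k * \<beta> $ k)"
      using half \<rho> by (fastforce simp: inner_add_right inner_axis mult_ac)
  qed
  then show "orient A k * \<beta> $ k \<ge> 0" .
  have "\<rho> \<le> \<beta> \<bullet> corner A"
  proof (rule affine_lower_bound(1))
    fix t :: real assume "t > 0"
    then have "corner A + t *\<^sub>R one \<in> W l u A"
      by (auto simp: W_iff one_def distrib_left mult.left_commute)
    then show "\<rho> \<le> \<beta> \<bullet> corner A + t * (\<beta> \<bullet> one)"
      using half \<rho> by (fastforce simp: inner_add_right)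
  qed
  then show "r A = ereal (\<beta> \<bullet> corner A)"
    using inner_corner_le_r[of \<beta> A] L sgn \<rho> by simp
qed

text \<open>At 0 the derivative of \<open>mgf\<close> along axis \<open>k\<close> is the negative
  mean of that coordinate, so a short positive step makes the constraint
  \<open>Lambda \<theta> \<le> 0\<close> strict.\<close>

lemma exists_slater_point:
  obtains t where "t > 0" "axis k t \<in> edom Lambda" "mgf (axis k t) < 1"
proof -
  have "expectation (\<lambda>\<omega>. exp (0 \<bullet> X 1 \<omega>) * (axis k 1 \<bullet> X 1 \<omega> + 0)) < 0"
    using negative_drift[of k] by (simp add: inner_axis')
  then have "\<forall>\<^sub>F n in sequentially. axis k (1 / Suc n) \<in> edom Lambda \<and> mgf (axis k (1 / Suc n)) < 1"
    using descent_direction(2)[OF open_dom zero_in_edom, of "axis k 1" 0]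
    by (simp add: mgf_zero axis_scale)
  then obtain n where "axis k (1 / Suc n) \<in> edom Lambda \<and> mgf (axis k (1 / Suc n)) < 1"
    by (auto simp: eventually_sequentially)
  then show ?thesis by (intro that[of "1 / Suc n"]) auto
qed

text \<open>A Slater point on the axis of some \<open>k \<in> A\<close> is sign-feasible and has
  value \<open>t * u > 0\<close> at the vertex.\<close>

lemma r_pos:
  assumes "A \<noteq> {}"
  shows "r A > 0"
proof -
  obtain k where k: "k \<in> A" using assms by auto
  obtain t where t: "t > 0" "axis k t \<in> edom Lambda" "mgf (axis k t) < 1"
    using exists_slater_point .
  then have "ereal (axis k t \<bullet> corner A) \<le> r A"
    using k by (intro inner_corner_le_r) (auto simp: Lambda_le_0_iff axis_def orient_def)
  moreover have "axis k t \<bullet> corner A > 0"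
    using k t(1) u_pos by (simp add: inner_axis' corner_def)
  ultimately show ?thesis
    by (metis ereal_less(2) less_le_trans)
qed

text \<open>Since \<open>\<beta>\<close> maximizes \<open>\<theta> \<bullet> corner A\<close> over the sign-constrained part of \<open>{\<Lambda> \<le> 0}\<close>, this is the
  Karush--Kuhn--Tucker condition; the constraints are coordinatewise, so it suffices to test it on
  directions supported on two coordinates.\<close>
lemma tilted_mean_direction:
  assumes "A \<noteq> {}" and \<beta>: "is_beta A \<beta>"
  obtains t where "t > 0" "\<And>k. orient A k * corner A $ k \<le> t * (orient A k * tilted_mean \<beta> $ k)"
    "\<beta> \<bullet> corner A = t * (\<beta> \<bullet> tilted_mean \<beta>)"
proof -
  note bp = beta_properties[OF \<beta>]
  define \<mu> where "\<mu> = tilted_mean \<beta>"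
  define v where "v = corner A"
  \<comment> \<open>\<open>T\<close> describes the directions tangent to the sign constraints at
    \<beta>: only constraints active there restrict \<open>h\<close>.\<close>
  define T where "T h \<longleftrightarrow> (\<forall>k. \<beta> $ k = 0 \<longrightarrow> orient A k * h $ k \<ge> 0)" for h :: "real ^ 'd"
  \<comment> \<open>If \<open>h\<close> is tangent and strictly decreases \<open>mgf\<close>, a
    short step from \<beta> along \<open>h\<close> is feasible, and optimality of \<beta> forbids an
    increase of the objective.\<close>
  have strict: "h \<bullet> v \<le> 0" if T: "T h" and neg: "h \<bullet> \<mu> < 0" for h
  proof -
    have "expectation (\<lambda>\<omega>. exp (\<beta> \<bullet> X 1 \<omega>) * (h \<bullet> X 1 \<omega> + 0)) < 0"
      using neg expectation_tilted_affine[OF open_dom bp(1), of h 0] by (simp add: \<mu>_def)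
    from descent_direction(2)[OF open_dom bp(1) this]
    have "\<forall>\<^sub>F n in sequentially. Lambda (\<beta> + (1 / Suc n) *\<^sub>R h) \<le> 0"
      by eventually_elim (auto simp: bp(2) Lambda_le_0_iff)
    \<comment> \<open>Where \<beta> vanishes the sign is ensured by \<open>T h\<close>; elsewhere it
      is strict at \<beta> and persists for small steps.\<close>
    moreover have "\<forall>\<^sub>F n in sequentially. orient A k * (\<beta> + (1 / Suc n) *\<^sub>R h) $ k \<ge> 0" for k
    proof (cases "\<beta> $ k = 0")
      case True
      then show ?thesis using T by (simp add: T_def)
    next
      case False
      have "(\<lambda>n. orient A k * (\<beta> + (1 / real (Suc n)) *\<^sub>R h) $ k) \<longlonglongrightarrow> orient A k * (\<beta> + 0 *\<^sub>R h) $ k"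
        using LIMSEQ_inverse_real_of_nat by (intro tendsto_intros) (simp add: inverse_eq_divide)
      moreover have "orient A k * (\<beta> + 0 *\<^sub>R h) $ k > 0"
        using False bp(3)[of k] by (simp add: less_le)
      ultimately have "\<forall>\<^sub>F n in sequentially. orient A k * (\<beta> + (1 / Suc n) *\<^sub>R h) $ k > 0"
        by (rule order_tendstoD(1))
      then show ?thesis by eventually_elim simp
    qed
    ultimately have "\<forall>\<^sub>F n in sequentially. Lambda (\<beta> + (1 / Suc n) *\<^sub>R h) \<le> 0 \<and>
        (\<forall>k. orient A k * (\<beta> + (1 / Suc n) *\<^sub>R h) $ k \<ge> 0)"
      by (intro eventually_conj eventually_all_finite)
    then obtain n where "Lambda (\<beta> + (1 / Suc n) *\<^sub>R h) \<le> 0"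
        "\<And>k. orient A k * (\<beta> + (1 / Suc n) *\<^sub>R h) $ k \<ge> 0"
      by (auto simp: eventually_sequentially)
    then have "(\<beta> + (1 / Suc n) *\<^sub>R h) \<bullet> v \<le> \<beta> \<bullet> v"
      using inner_corner_le_r bp(4) by (fastforce simp: v_def)
    then show ?thesis by (simp add: inner_add_left divide_le_0_iff)
  qed
  obtain k1 where k1: "k1 \<in> A" using assms(1) by auto
  obtain c where c: "c > 0" "axis k1 c \<in> edom Lambda" "mgf (axis k1 c) < 1"
    using exists_slater_point .
  \<comment> \<open>The direction from \<beta> to a Slater point decreases \<open>mgf\<close>
    strictly, by the convexity bound \<open>1 + y \<le> exp y\<close> under the tilt. It is used to
    perturb directions that decrease \<open>mgf\<close> only weakly.\<close>
  define h0 where "h0 = axis k1 c - \<beta>"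
  have T0: "T h0"
    using c(1) k1 by (auto simp: T_def h0_def axis_def orient_def)
  have "h0 \<bullet> \<mu> \<le> mgf (axis k1 c) - mgf \<beta>"
  proof -
    have "h0 \<bullet> \<mu> = expectation (\<lambda>\<omega>. exp (\<beta> \<bullet> X 1 \<omega>) * (h0 \<bullet> X 1 \<omega> + 0))"
      by (subst expectation_tilted_affine[OF open_dom bp(1)]) (simp add: \<mu>_def)
    also have "\<dots> \<le> expectation (\<lambda>\<omega>. exp (axis k1 c \<bullet> X 1 \<omega>) - exp (\<beta> \<bullet> X 1 \<omega>))"
    proof (rule integral_mono)
      show "integrable M (\<lambda>\<omega>. exp (axis k1 c \<bullet> X 1 \<omega>) - exp (\<beta> \<bullet> X 1 \<omega>))"
        using c(2) bp(1) by (auto simp: edom_iff)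
      fix \<omega>
      have "h0 \<bullet> X 1 \<omega> \<le> exp (h0 \<bullet> X 1 \<omega>) - 1"
        using exp_ge_add_one_self[of "h0 \<bullet> X 1 \<omega>"] by linarith
      then have "exp (\<beta> \<bullet> X 1 \<omega>) * (h0 \<bullet> X 1 \<omega>) \<le> exp (\<beta> \<bullet> X 1 \<omega>) * (exp (h0 \<bullet> X 1 \<omega>) - 1)"
        by (intro mult_left_mono) auto
      then show "exp (\<beta> \<bullet> X 1 \<omega>) * (h0 \<bullet> X 1 \<omega> + 0) \<le> exp (axis k1 c \<bullet> X 1 \<omega>) - exp (\<beta> \<bullet> X 1 \<omega>)"
        by (simp add: h0_def inner_diff_left algebra_simps exp_diff)
    qed (rule descent_direction(1)[OF open_dom bp(1)])
    also have "\<dots> = mgf (axis k1 c) - mgf \<beta>"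
      unfolding mgf_def using c(2) bp(1) by (intro Bochner_Integration.integral_diff) (auto simp: edom_iff)
    finally show ?thesis .
  qed
  then have neg0: "h0 \<bullet> \<mu> < 0" using c(3) bp(2) by simp
  \<comment> \<open>Apply \<open>strict\<close> to \<open>h + t *\<^sub>R h0\<close> and let
    \<open>t\<close> tend to 0.\<close>
  have weak: "h \<bullet> v \<le> 0" if "T h" "h \<bullet> \<mu> \<le> 0" for h
  proof -
    have "0 \<le> - (h \<bullet> v) + t * (- (h0 \<bullet> v))" if "t > 0" for t
    proof -
      have "T (h + t *\<^sub>R h0)"
        using \<open>T h\<close> T0 \<open>t > 0\<close>
        by (auto simp: T_def distrib_left mult.left_commute[of _ t] intro!: add_nonneg_nonneg)
      moreover have "(h + t *\<^sub>R h0) \<bullet> \<mu> < 0"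
        using \<open>h \<bullet> \<mu> \<le> 0\<close> neg0 \<open>t > 0\<close> mult_pos_neg[of t "h0 \<bullet> \<mu>"] by (simp add: inner_add_left)
      ultimately show ?thesis using strict[of "h + t *\<^sub>R h0"] by (simp add: inner_add_left)
    qed
    from affine_lower_bound(1)[of 0, OF this] show ?thesis by simp
  qed
  define m where "m k = orient A k * \<mu> $ k" for k
  define a where "a k = orient A k * v $ k" for k
  have a_pos: "a k > 0" for k by (simp add: a_def v_def orient_corner_pos)
  have inner_m: "axis k x \<bullet> \<mu> = orient A k * x * m k" and inner_a: "axis k x \<bullet> v = orient A k * x * a k" for k x
    by (simp_all add: inner_axis' m_def a_def orient_def)
  \<comment> \<open>Otherwise moving along the oriented axis \<open>j\<close> would not increase
    \<open>mgf\<close> to first order, yet would strictly increase the objective.\<close>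
  have m_pos: "m j > 0" if "\<beta> $ j \<noteq> 0" for j
  proof (rule ccontr)
    assume "\<not> m j > 0"
    then have "axis j (orient A j) \<bullet> v \<le> 0"
      using that by (intro weak) (auto simp: T_def axis_nth_if inner_m)
    then show False using a_pos[of j] by (simp add: inner_a)
  qed
  have key: "a i * m j \<le> a j * m i" if j: "\<beta> $ j \<noteq> 0" for i j
  proof (cases "i = j")
    case False
    \<comment> \<open>An exchange of coordinates \<open>i\<close> and \<open>j\<close>, balanced so
      that \<open>h \<bullet> \<mu> = 0\<close>. Coordinate \<open>j\<close> may move in either
      direction because its sign constraint is inactive.\<close>
    define h where "h = axis i (orient A i) - axis j (orient A j * (m i / m j))"
    have "h \<bullet> v \<le> 0"
      using j m_pos[OF j] False
      by (intro weak) (auto simp: T_def h_def axis_nth_if inner_diff_left inner_m)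
    then show ?thesis using m_pos[OF j] by (simp add: h_def inner_diff_left inner_a field_simps)
  qed simp
  have "\<beta> \<bullet> v > 0"
    using r_pos[OF assms(1)] bp(4) by (simp add: v_def)
  \<comment> \<open>Any coordinate with \<beta> nonzero yields the multiplier
    \<open>a j / m j\<close>. For two such coordinates \<open>key\<close> applies both ways and
    gives equality of the ratios, which is complementary slackness.\<close>
  then obtain j where j: "\<beta> $ j \<noteq> 0"
    by (metis inner_zero_left less_irrefl vec_eq_iff zero_index)
  show ?thesis
  proof (rule that)
    show "a j / m j > 0" using a_pos m_pos[OF j] by simp
    show "orient A k * corner A $ k \<le> a j / m j * (orient A k * tilted_mean \<beta> $ k)" for k
    proof -
      have "a k \<le> a j / m j * m k"
        using key[OF j, of k] m_pos[OF j] by (simp add: pos_le_divide_eq)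
      then show ?thesis by (simp only: a_def[of k] m_def[of k] \<mu>_def v_def)
    qed
    have "\<beta> $ k * v $ k = a j / m j * (\<beta> $ k * \<mu> $ k)" for k
    proof (cases "\<beta> $ k = 0")
      case False
      then have "a k * m j = a j * m k"
        using key[OF j, of k] key[OF False, of j] by (simp add: mult.commute)
      then have "orient A k * (v $ k * m j) = orient A k * (a j * \<mu> $ k)"
        by (simp only: a_def[of k] m_def[of k] mult.assoc mult.left_commute[of "a j"])
      then have "v $ k = a j / m j * \<mu> $ k"
        using m_pos[OF j] by (simp add: eq_divide_eq)
      then show ?thesis by simp
    qed simp
    then have "\<beta> \<bullet> v = a j / m j * (\<beta> \<bullet> \<mu>)"
      unfolding inner_vec_def inner_real_def sum_distrib_left by (intro sum.cong) simp_all
    then show "\<beta> \<bullet> corner A = a j / m j * (\<beta> \<bullet> tilted_mean \<beta>)"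
      by (simp only: v_def \<mu>_def)
  qed
qed

end

section \<open>Exit events\<close>

context siegmund
begin

definition hit :: "real \<Rightarrow> nat \<Rightarrow> 'a \<Rightarrow> bool" where
  "hit b n \<omega> \<longleftrightarrow> (\<exists>A. A \<noteq> {} \<and> S n \<omega> \<in> (*\<^sub>R) b ` W l u A)"

text \<open>The event \<open>tau_star b \<omega> = n\<close> and
  \<open>n < tau b {} \<omega>\<close>, written through the positions up to time \<open>n\<close> so
  that it visibly belongs to \<open>F n\<close>. These events split the random exit time into
  deterministic times.\<close>

definition exit_at :: "real \<Rightarrow> nat \<Rightarrow> 'a set" where
  "exit_at b n = {\<omega>\<in>space M. hit b n \<omega> \<and> (\<forall>j<n. \<not> hit b j \<omega>) \<and>
     (\<forall>j\<le>n. S j \<omega> \<notin> (*\<^sub>R) b ` W l u {})}"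

definition rare_event :: "real \<Rightarrow> 'a set" where
  "rare_event b = {\<omega>\<in>space M. tau_star b \<omega> < tau b {} \<omega>}"

lemma tau_le_iff: "tau b A \<omega> \<le> enat n \<longleftrightarrow> (\<exists>j\<le>n. S j \<omega> \<in> (*\<^sub>R) b ` W l u A)"
proof
  let ?H = "{enat n |n. S n \<omega> \<in> (*\<^sub>R) b ` W l u A}"
  assume le: "tau b A \<omega> \<le> enat n"
  have "?H \<noteq> {}"
  proof
    assume "?H = {}"
    then have "tau b A \<omega> = \<infinity>" unfolding tau_def by (simp add: Inf_enat_def)
    then show False using le by simp
  qed
  \<comment> \<open>An infimum of a nonempty set in \<open>enat\<close> is a least element, hence
    attained.\<close>
  then have "Inf ?H \<in> ?H"
    unfolding Inf_enat_def by (metis (mono_tags, lifting) LeastI_ex ex_in_conv)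
  then obtain m where "Inf ?H = enat m" "S m \<omega> \<in> (*\<^sub>R) b ` W l u A"
    by blast
  then show "\<exists>j\<le>n. S j \<omega> \<in> (*\<^sub>R) b ` W l u A"
    using le by (intro exI[of _ m]) (simp add: tau_def)
next
  assume "\<exists>j\<le>n. S j \<omega> \<in> (*\<^sub>R) b ` W l u A"
  then obtain j where "j \<le> n" "S j \<omega> \<in> (*\<^sub>R) b ` W l u A" by auto
  then show "tau b A \<omega> \<le> enat n"
    unfolding tau_def by (intro Inf_lower2[of "enat j"]) auto
qed

lemma tau_star_le_iff: "tau_star b \<omega> \<le> enat n \<longleftrightarrow> (\<exists>j\<le>n. hit b j \<omega>)"
proof
  assume "tau_star b \<omega> \<le> enat n"
  then have "tau_star b \<omega> < enat (Suc n)" by (rule le_less_trans) simp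
  then obtain A where "A \<noteq> {}" "tau b A \<omega> < enat (Suc n)"
    unfolding tau_star_def by (auto simp: INF_less_iff)
  then have "tau b A \<omega> \<le> enat n" by (cases "tau b A \<omega>") simp_all
  then show "\<exists>j\<le>n. hit b j \<omega>"
    using \<open>A \<noteq> {}\<close> unfolding tau_le_iff hit_def by blast
next
  assume "\<exists>j\<le>n. hit b j \<omega>"
  then obtain j A where *: "j \<le> n" "A \<noteq> {}" "S j \<omega> \<in> (*\<^sub>R) b ` W l u A" by (auto simp: hit_def)
  then have "tau b A \<omega> \<le> enat n" by (auto simp: tau_le_iff)
  then show "tau_star b \<omega> \<le> enat n"
    unfolding tau_star_def using *(2) by (intro INF_lower2) auto
qed

lemma exit_at_tau:
  assumes "\<omega> \<in> exit_at b n"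
  shows "tau_star b \<omega> = enat n" "enat n < tau b {} \<omega>"
proof -
  have "tau_star b \<omega> \<le> enat n" using assms by (auto simp: tau_star_le_iff exit_at_def)
  moreover have "\<not> tau_star b \<omega> \<le> enat m" if "m < n" for m
    using assms that by (auto simp: tau_star_le_iff exit_at_def)
  ultimately show "tau_star b \<omega> = enat n"
    by (cases "tau_star b \<omega>") (auto simp: not_le le_less)
  show "enat n < tau b {} \<omega>"
    using assms by (simp add: tau_le_iff exit_at_def flip: not_le)
qed

lemma rare_eventI:
  assumes "\<omega> \<in> space M" "hit b n \<omega>" "\<And>j. j \<le> n \<Longrightarrow> S j \<omega> \<notin> (*\<^sub>R) b ` W l u {}"
  shows "\<omega> \<in> rare_event b"
proof -
  have "tau_star b \<omega> \<le> enat n" using assms(2) by (auto simp: tau_star_le_iff)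
  moreover have "enat n < tau b {} \<omega>"
    using assms(3) by (auto simp: tau_le_iff simp flip: not_le)
  ultimately show ?thesis using assms(1) by (auto simp: rare_event_def)
qed

lemma rare_event_eq: "rare_event b = (\<Union>n. exit_at b n)"
proof
  show "(\<Union>n. exit_at b n) \<subseteq> rare_event b"
    by (auto intro!: rare_eventI simp: exit_at_def)
  show "rare_event b \<subseteq> (\<Union>n. exit_at b n)"
  proof
    fix \<omega> assume \<omega>: "\<omega> \<in> rare_event b"
    then obtain n where n: "tau_star b \<omega> = enat n" by (cases "tau_star b \<omega>") (auto simp: rare_event_def)
    then have "\<exists>j\<le>n. hit b j \<omega>" using tau_star_le_iff[of b \<omega> n] by simp
    moreover have no: "\<not> hit b j \<omega>" if "j < n" for j
      using tau_star_le_iff[of b \<omega> j] n that by auto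
    ultimately have "hit b n \<omega>" by (auto simp: le_less)
    moreover have "\<not> tau b {} \<omega> \<le> enat n" using \<omega> n by (simp add: rare_event_def not_le)
    ultimately have "\<omega> \<in> exit_at b n"
      using \<omega> no by (auto simp: exit_at_def rare_event_def tau_le_iff)
    then show "\<omega> \<in> (\<Union>n. exit_at b n)" by auto
  qed
qed

lemma disjoint_exit_at: "disjoint_family (exit_at b)"
  unfolding disjoint_family_on_def
proof (intro ballI impI)
  fix m n :: nat assume "m \<noteq> n"
  have False if "\<omega> \<in> exit_at b m" "\<omega> \<in> exit_at b n" for \<omega>
    using exit_at_tau(1)[OF that(1)] exit_at_tau(1)[OF that(2)] \<open>m \<noteq> n\<close> by simp
  then show "exit_at b m \<inter> exit_at b n = {}" by blast
qed

lemma scaled_W_sets: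
  assumes b: "b > 0"
  shows "(*\<^sub>R) b ` W l u (A :: 'd set) \<in> sets borel"
proof -
  have "(*\<^sub>R) b ` W l u A = {x. \<forall>k. b * (orient A k * corner A $ k) < orient A k * x $ k}"
    using scaled_W_iff[OF b] by blast
  also have "\<dots> = (\<Inter>k. {x. b * (orient A k * corner A $ k) < orient A k * x $ k})" by auto
  also have "\<dots> \<in> sets borel"
    by (intro borel_open open_INT ballI open_Collect_less continuous_intros) auto
  finally show ?thesis .
qed

lemma S_in_W_sets:
  assumes "b > 0" "j \<le> n"
  shows "{\<omega>\<in>space (F n). S j \<omega> \<in> (*\<^sub>R) b ` W l u A} \<in> sets (F n)"
  using S_measurable_F[OF assms(2)] scaled_W_sets[OF assms(1)] by measurable

lemma hit_sets:
  assumes "b > 0" "j \<le> n"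
  shows "{\<omega>\<in>space (F n). hit b j \<omega>} \<in> sets (F n)"
proof -
  have "{\<omega>\<in>space (F n). hit b j \<omega>}
      = (\<Union>A\<in>{A. A \<noteq> {}}. {\<omega>\<in>space (F n). S j \<omega> \<in> (*\<^sub>R) b ` W l u A})"
    unfolding hit_def by blast
  then show ?thesis using S_in_W_sets[OF assms] by (simp add: sets.finite_UN)
qed

lemma exit_at_sets:
  assumes "b > 0"
  shows "exit_at b n \<in> sets (F n)"
proof -
  have "{\<omega>\<in>space (F n). hit b n \<omega> \<and> (\<forall>j\<in>{..<n}. \<not> hit b j \<omega>) \<and>
     (\<forall>j\<in>{..n}. S j \<omega> \<notin> (*\<^sub>R) b ` W l u {})} \<in> sets (F n)"
    using assms
    by (intro sets.sets_Collect_conj sets.sets_Collect_finite_All sets.sets_Collect_neg hit_sets S_in_W_sets)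
      auto
  then show ?thesis by (simp add: exit_at_def lessThan_iff atMost_iff Ball_def)
qed

lemma rare_event_sets: "b > 0 \<Longrightarrow> rare_event b \<in> sets M"
  unfolding rare_event_eq using exit_at_sets subalgebra_F
  by (intro sets.countable_UN) (auto simp: subalgebra_def)

text \<open>Under \<open>N\<close> the scalar walk
  \<open>h \<bullet> S n \<omega> + c * real n\<close> has negative drift. Markov's inequality for
  its exponential, rewritten under \<open>M\<close>, gives the base
  \<open>exp (t * c) * mgf (\<beta> + t *\<^sub>R h)\<close>, which is below 1 for a suitable small
  \<open>t\<close> by \<open>descent_direction\<close>.\<close>

lemma tilted_chernoff:
  assumes \<beta>: "\<beta> \<in> edom Lambda" "mgf \<beta> = 1" and N: "is_tilted \<beta> N"
    and neg: "h \<bullet> tilted_mean \<beta> + c < 0"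
  shows "\<exists>t \<rho>. 0 < t \<and> 0 < \<rho> \<and> \<rho> < 1 \<and>
    (\<forall>n a. measure N {\<omega>\<in>space M. a \<le> h \<bullet> S n \<omega> + c * real n} \<le> exp (- t * a) * \<rho> ^ n)"
proof -
  have "expectation (\<lambda>\<omega>. exp (\<beta> \<bullet> X 1 \<omega>) * (h \<bullet> X 1 \<omega> + c)) < 0"
    using neg expectation_tilted_affine[OF open_dom \<beta>(1)] \<beta>(2) by simp
  from descent_direction(2)[OF open_dom \<beta>(1) this] obtain m where
    m: "\<beta> + (1 / Suc m) *\<^sub>R h \<in> edom Lambda" "exp (c / Suc m) * mgf (\<beta> + (1 / Suc m) *\<^sub>R h) < mgf \<beta>"
    by (auto simp: eventually_sequentially)
  define t where "t = 1 / real (Suc m)"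
  define \<rho> where "\<rho> = exp (t * c) * mgf (\<beta> + t *\<^sub>R h)"
  have \<rho>: "0 < \<rho>" "\<rho> < 1"
    using m mgf_pos[OF m(1)] \<beta>(2) by (auto simp: \<rho>_def t_def)
  have "measure N {\<omega>\<in>space M. a \<le> h \<bullet> S n \<omega> + c * real n} \<le> exp (- t * a) * \<rho> ^ n" for n a
  proof -
    define B where "B = {\<omega>\<in>space M. a \<le> h \<bullet> S n \<omega> + c * real n}"
    have [measurable]: "S n \<in> borel_measurable (F n)" by (rule S_measurable_F) simp
    have BF: "B \<in> sets (F n)"
    proof -
      have "{\<omega>\<in>space (F n). a \<le> h \<bullet> S n \<omega> + c * real n} \<in> sets (F n)" by measurable
      then show ?thesis by (simp add: B_def)
    qed
    then have BN: "B \<in> sets N" using tilted_subalgebra[OF N] by (auto simp: subalgebra_def)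
    have sp: "space N = space M" using N by (auto simp: is_tilted_def dest: sets_eq_imp_space_eq)
    have "emeasure N B = (\<integral>\<^sup>+\<omega>. indicator B \<omega> \<partial>N)" using BN by simp
    also have "\<dots> \<le> (\<integral>\<^sup>+\<omega>. ennreal (exp (t * (h \<bullet> S n \<omega> + c * real n - a))) \<partial>N)"
      by (intro nn_integral_mono) (auto simp: indicator_def B_def t_def intro!: ennreal_ge_1[THEN iffD2])
    also have "\<dots> = (\<integral>\<^sup>+\<omega>. ennreal (exp (\<beta> \<bullet> S n \<omega> - real n * real_of_ereal (Lambda \<beta>))) *
        ennreal (exp (t * (h \<bullet> S n \<omega> + c * real n - a))) \<partial>M)"
      by (intro nn_integral_tilted N) measurable
    also have "\<dots> = (\<integral>\<^sup>+\<omega>. ennreal (exp (- t * a) * exp (t * c) ^ n) *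
        ennreal (exp ((\<beta> + t *\<^sub>R h) \<bullet> S n \<omega>)) \<partial>M)"
    proof (intro nn_integral_cong)
      fix \<omega>
      have "exp (\<beta> \<bullet> S n \<omega>) * exp (t * (h \<bullet> S n \<omega> + c * real n - a))
          = exp (- t * a) * exp (real n * (t * c)) * exp ((\<beta> + t *\<^sub>R h) \<bullet> S n \<omega>)"
        unfolding exp_add[symmetric] by (simp add: inner_add_left algebra_simps)
      then show "ennreal (exp (\<beta> \<bullet> S n \<omega> - real n * real_of_ereal (Lambda \<beta>))) *
          ennreal (exp (t * (h \<bullet> S n \<omega> + c * real n - a)))
          = ennreal (exp (- t * a) * exp (t * c) ^ n) * ennreal (exp ((\<beta> + t *\<^sub>R h) \<bullet> S n \<omega>))"
        by (simp add: Lambda_eq[OF \<beta>(1)] \<beta>(2) ennreal_mult[symmetric] exp_of_nat_mult)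
    qed
    also have "\<dots> = ennreal (exp (- t * a) * exp (t * c) ^ n) * ennreal (mgf (\<beta> + t *\<^sub>R h) ^ n)"
      using m(1) S_measurable[of n]
      by (subst nn_integral_cmult) (auto simp: nn_integral_exp_S t_def)
    also have "\<dots> = ennreal (exp (- t * a) * \<rho> ^ n)"
      using mgf_pos[OF m(1)] by (simp add: \<rho>_def power_mult_distrib mult.assoc t_def flip: ennreal_mult)
    finally show ?thesis
      unfolding measure_def B_def[symmetric] using \<rho>(1) by (intro enn2real_leI) auto
  qed
  then show ?thesis using \<rho> by (intro exI[of _ t] exI[of _ \<rho>]) (auto simp: t_def)
qed

end

section \<open>Lower bound for the exit probability\<close>

context siegmund
begin

text \<open>Under the tilted law three kinds of failure become unlikely: missing the target orthant
  at time \<open>n b\<close>, an excessive value of \<open>\<beta> \<bullet> S\<close>, and an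
  earlier visit to the orthant of \<open>{}\<close>. On the remaining event the tilt is undone at a
  controlled cost. One factor \<open>1 + \<epsilon>\<close> pays for the later time, the other for
  the overestimated speed.\<close>

lemma rare_event_lower_bound:
  assumes A: "A \<noteq> {}" and \<beta>: "is_beta A \<beta>" and N: "is_tilted \<beta> N" and \<epsilon>: "\<epsilon> > 0"
  obtains K where
    "\<forall>\<^sub>F b in at_top. exp (- ((1 + \<epsilon>)\<^sup>2 * (\<beta> \<bullet> corner A) * b + K)) \<le> prob (rare_event b)"
proof -
  note bp = beta_properties[OF \<beta>]
  interpret N: prob_space N using N by (simp add: is_tilted_def)
  have sets_N: "sets N = sets M" and space_N: "space N = space M"
    using N by (auto simp: is_tilted_def dest: sets_eq_imp_space_eq)
  define \<rho> where "\<rho> = \<beta> \<bullet> corner A"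
  have \<rho>: "\<rho> > 0" using r_pos[OF A] bp(4) by (simp add: \<rho>_def)
  define a where "a i = orient A i * corner A $ i" for i
  have a: "a i > 0" for i unfolding a_def by (rule orient_corner_pos)
  obtain t where t: "t > 0" "\<And>i. a i \<le> t * (orient A i * tilted_mean \<beta> $ i)"
      "\<rho> = t * (\<beta> \<bullet> tilted_mean \<beta>)"
    using tilted_mean_direction[OF A \<beta>] unfolding a_def \<rho>_def by metis
  obtain k where k: "k \<in> A" using A by auto
  \<comment> \<open>Waiting slightly longer than the optimal time turns the weak inequalities for
    the drift into strict ones, so every barrier is passed with room to spare.\<close>
  define T where "T = (1 + \<epsilon>) * t"
  have T: "T > 0" using t(1) \<epsilon> by (simp add: T_def)
  have S_meas [measurable]: "S n \<in> borel_measurable M" for n by (rule S_measurable)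

  have "\<exists>q. 0 < q \<and> q < 1 \<and>
      (\<forall>n. measure N {\<omega>\<in>space M. 0 \<le> axis i (- orient A i) \<bullet> S n \<omega> + a i / T * real n} \<le> q ^ n)" for i
  proof -
    have "a i < (1 + \<epsilon>) * a i" using a[of i] \<epsilon> by simp
    also have "\<dots> \<le> (1 + \<epsilon>) * (t * (orient A i * tilted_mean \<beta> $ i))"
      using t(2)[of i] \<epsilon> by (intro mult_left_mono) auto
    finally have "a i / T < orient A i * tilted_mean \<beta> $ i"
      using T by (simp add: pos_divide_less_eq T_def mult_ac)
    then have "axis i (- orient A i) \<bullet> tilted_mean \<beta> + a i / T < 0"
      by (simp add: inner_axis')
    then obtain s y where "s > 0" "0 < y" "y < 1"
      "\<And>n x. measure N {\<omega>\<in>space M. x \<le> axis i (- orient A i) \<bullet> S n \<omega> + a i / T * real n}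
         \<le> exp (- s * x) * y ^ n"
      by (blast dest: tilted_chernoff[OF bp(1,2) N])
    from this(2,3) this(4)[of 0] show ?thesis by (intro exI[of _ y]) simp
  qed
  then have "\<exists>q. \<forall>i. 0 < q i \<and> q i < 1 \<and> (\<forall>n. measure N {\<omega>\<in>space M.
      0 \<le> axis i (- orient A i) \<bullet> S n \<omega> + a i / T * real n} \<le> q i ^ n)"
    by (intro choice allI)
  then obtain q where "\<forall>i. 0 < q i \<and> q i < 1 \<and> (\<forall>n. measure N {\<omega>\<in>space M.
      0 \<le> axis i (- orient A i) \<bullet> S n \<omega> + a i / T * real n} \<le> q i ^ n)"
    by (elim exE)
  then have q: "0 < q i" "q i < 1" "measure N {\<omega>\<in>space M.
      0 \<le> axis i (- orient A i) \<bullet> S n \<omega> + a i / T * real n} \<le> q i ^ n" for i n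
    by (blast, blast, blast)

  \<comment> \<open>By complementary slackness the speed of \<open>\<beta> \<bullet> S\<close> under
    the tilt is \<open>\<rho> / t\<close>; \<open>c\<close> is slightly larger.\<close>
  define c where "c = (1 + \<epsilon>) * \<rho> / t"
  have c: "c > 0" using \<rho> t(1) \<epsilon> by (simp add: c_def)
  have "\<rho> / t < c" using \<rho> t(1) \<epsilon> by (simp add: c_def divide_strict_right_mono)
  then have "\<beta> \<bullet> tilted_mean \<beta> + - c < 0" using t(1,3) by simp
  then obtain s' q' where "s' > 0" and q': "0 < q'" "q' < 1"
      "\<And>n x. measure N {\<omega>\<in>space M. x \<le> \<beta> \<bullet> S n \<omega> + - c * real n} \<le> exp (- s' * x) * q' ^ n"
    by (blast dest: tilted_chernoff[OF bp(1,2) N])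

  \<comment> \<open>A coordinate \<open>k \<in> A\<close> drifts upwards, whereas a visit to the
    scaled orthant of \<open>{}\<close> requires it to fall below \<open>- l * b\<close>. The factor
    \<open>p ^ j\<close> makes these probabilities summable over all times \<open>j\<close>.\<close>
  have "t * tilted_mean \<beta> $ k > 0"
    using t(2)[of k] a[of k] k by (simp add: orient_def)
  then have "axis k (- 1) \<bullet> tilted_mean \<beta> + 0 < 0"
    using t(1) by (simp add: inner_axis' zero_less_mult_iff)
  then obtain s p where p: "s > 0" "0 < p" "p < 1"
      "\<And>n x. measure N {\<omega>\<in>space M. x \<le> axis k (- 1) \<bullet> S n \<omega> + 0 * real n} \<le> exp (- s * x) * p ^ n"
    by (blast dest: tilted_chernoff[OF bp(1,2) N])

  \<comment> \<open>Rounding up keeps every barrier passed and adds at most one step, which accounts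
    for the summand \<open>c\<close> in \<open>B b\<close>.\<close>
  define n where "n b = nat \<lceil>b * T\<rceil>" for b :: real
  have n_ge: "b * T \<le> real (n b)" for b unfolding n_def by linarith
  have n_le: "real (n b) \<le> b * T + 1" if "b > 0" for b
    unfolding n_def using that T by (auto simp: of_nat_nat intro: less_imp_le)
  have n_lim: "filterlim n at_top at_top"
    unfolding filterlim_at_top
  proof
    fix Z
    show "\<forall>\<^sub>F b in at_top. Z \<le> n b"
      using eventually_ge_at_top[of "real Z / T"]
    proof eventually_elim
      case (elim b)
      then have "real Z \<le> b * T" using T by (simp add: pos_divide_le_eq)
      then show ?case using n_ge[of b] by linarith
    qed
  qed

  define u' where "u' b = (\<Sum>i\<in>UNIV. q i ^ n b) + q' ^ n b + exp (- s * (l * b)) * (1 / (1 - p))" for b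
  have u'_lim: "(u' \<longlongrightarrow> 0) at_top"
  proof -
    have pow: "((\<lambda>b. x ^ n b) \<longlongrightarrow> 0) at_top" if "0 < x" "x < 1" for x :: real
      by (rule filterlim_compose[OF LIMSEQ_power_zero n_lim]) (use that in auto)
    have "filterlim (\<lambda>b. (- (s * l)) * b) at_bot at_top"
      using p(1) l_pos
      by (intro filterlim_tendsto_neg_mult_at_bot[OF tendsto_const _ filterlim_ident]) auto
    then have "((\<lambda>b. exp ((- (s * l)) * b)) \<longlongrightarrow> 0) at_top"
      by (rule filterlim_compose[OF exp_at_bot])
    then have "((\<lambda>b. exp (- s * (l * b))) \<longlongrightarrow> 0) at_top" by (simp add: mult.assoc)
    then have "(u' \<longlongrightarrow> (\<Sum>i\<in>(UNIV::'d set). 0) + 0 + 0 * (1 / (1 - p))) at_top"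
      unfolding u'_def by (intro tendsto_intros pow q(1,2) q'(1,2))
    then show ?thesis by simp
  qed

  define B where "B b = (1 + \<epsilon>)\<^sup>2 * \<rho> * b + c" for b
  have bound: "exp (- B b) / 2 \<le> prob (rare_event b)" if b: "b > 0" and half: "u' b < 1 / 2" for b
  proof -
    define G where "G = {\<omega>\<in>space (F (n b)). S (n b) \<omega> \<in> (*\<^sub>R) b ` W l u A \<and>
      (\<forall>j\<in>{..n b}. S j \<omega> \<notin> (*\<^sub>R) b ` W l u {}) \<and> \<beta> \<bullet> S (n b) \<omega> \<le> B b}"
    define bad1 where "bad1 i = {\<omega>\<in>space M. 0 \<le> axis i (- orient A i) \<bullet> S (n b) \<omega> + a i / T * real (n b)}" for i
    define bad2 where "bad2 = {\<omega>\<in>space M. 0 \<le> \<beta> \<bullet> S (n b) \<omega> + - c * real (n b)}"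
    define bad3 where "bad3 j = {\<omega>\<in>space M. l * b \<le> axis k (- 1) \<bullet> S j \<omega> + 0 * real j}" for j
    have "{\<omega>\<in>space (F (n b)). \<beta> \<bullet> S (n b) \<omega> \<le> B b} \<in> sets (F (n b))"
      using S_measurable_F[of "n b" "n b"] by measurable
    then have G_F: "G \<in> sets (F (n b))"
      unfolding G_def using b
      by (intro sets.sets_Collect_conj sets.sets_Collect_finite_All sets.sets_Collect_neg S_in_W_sets) auto
    then have G_M: "G \<in> sets M" using subalgebra_F by (auto simp: subalgebra_def)
    have bad_sets: "bad1 i \<in> sets N" "bad2 \<in> sets N" "bad3 j \<in> sets N" for i j
      unfolding bad1_def bad2_def bad3_def sets_N by measurable
    have cover: "space N - G \<subseteq> (\<Union>i\<in>UNIV. bad1 i) \<union> bad2 \<union> (\<Union>j\<in>{..n b}. bad3 j)"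
    proof (rule subsetI, rule ccontr)
      fix \<omega> assume *: "\<omega> \<in> space N - G"
        "\<omega> \<notin> (\<Union>i\<in>UNIV. bad1 i) \<union> bad2 \<union> (\<Union>j\<in>{..n b}. bad3 j)"
      have \<omega>: "\<omega> \<in> space M" "\<omega> \<notin> G" "\<omega> \<notin> bad1 i" "\<omega> \<notin> bad2"
          "j \<le> n b \<Longrightarrow> \<omega> \<notin> bad3 j" for i j
        using * by (auto simp: space_N)
      have "b * a i < orient A i * S (n b) \<omega> $ i" for i
      proof -
        have "b * a i = a i / T * (b * T)" using T by simp
        also have "\<dots> \<le> a i / T * real (n b)"
          using n_ge a[of i] T by (intro mult_left_mono) auto
        also have "\<dots> < orient A i * S (n b) \<omega> $ i"
          using \<omega>(1) \<omega>(3)[of i] by (auto simp: bad1_def inner_axis')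
        finally show ?thesis .
      qed
      then have "S (n b) \<omega> \<in> (*\<^sub>R) b ` W l u A" by (simp add: scaled_W_iff[OF b] a_def)
      moreover have "S j \<omega> \<notin> (*\<^sub>R) b ` W l u {}" if "j \<le> n b" for j
      proof -
        have "- (S j \<omega> $ k) < l * b" using \<omega>(1) \<omega>(5)[OF that] by (simp add: bad3_def inner_axis')
        then have "\<not> b * (orient {} k * corner {} $ k) < orient {} k * S j \<omega> $ k"
          by (simp add: orient_def corner_def mult.commute)
        then show ?thesis by (auto simp only: scaled_W_iff[OF b])
      qed
      moreover have "\<beta> \<bullet> S (n b) \<omega> \<le> B b"
      proof -
        have "\<beta> \<bullet> S (n b) \<omega> \<le> c * real (n b)" using \<omega>(1,4) by (simp add: bad2_def)
        also have "\<dots> \<le> c * (b * T + 1)" using n_le[OF b] c by (intro mult_left_mono) auto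
        also have "\<dots> = B b"
          using t(1) by (simp add: B_def c_def T_def power2_eq_square field_simps)
        finally show ?thesis .
      qed
      ultimately show False using \<omega>(1,2) by (simp add: G_def)
    qed
    have "measure N (space N - G) \<le> measure N ((\<Union>i\<in>UNIV. bad1 i) \<union> bad2 \<union> (\<Union>j\<in>{..n b}. bad3 j))"
      using cover bad_sets by (intro N.finite_measure_mono sets.Un sets.finite_UN) auto
    also have "\<dots> \<le> (measure N (\<Union>i\<in>UNIV. bad1 i) + measure N bad2) + measure N (\<Union>j\<in>{..n b}. bad3 j)"
      using bad_sets
      by (intro order_trans[OF measure_Un_le] add_mono measure_Un_le
          sets.Un sets.finite_UN order_refl) auto
    also have "\<dots> \<le> ((\<Sum>i\<in>UNIV. q i ^ n b) + q' ^ n b) + (\<Sum>j\<le>n b. exp (- s * (l * b)) * p ^ j)"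
    proof (intro add_mono)
      have "measure N (\<Union>i\<in>UNIV. bad1 i) \<le> (\<Sum>i\<in>UNIV. measure N (bad1 i))"
        using bad_sets by (intro measure_UNION_le) auto
      also have "\<dots> \<le> (\<Sum>i\<in>UNIV. q i ^ n b)"
        unfolding bad1_def by (intro sum_mono q(3))
      finally show "measure N (\<Union>i\<in>UNIV. bad1 i) \<le> (\<Sum>i\<in>UNIV. q i ^ n b)" .
      show "measure N bad2 \<le> q' ^ n b" using q'(3)[of 0 "n b"] by (simp add: bad2_def)
      have "measure N (\<Union>j\<in>{..n b}. bad3 j) \<le> (\<Sum>j\<le>n b. measure N (bad3 j))"
        using bad_sets by (intro measure_UNION_le) auto
      also have "\<dots> \<le> (\<Sum>j\<le>n b. exp (- s * (l * b)) * p ^ j)"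
        unfolding bad3_def by (intro sum_mono p(4))
      finally show "measure N (\<Union>j\<in>{..n b}. bad3 j) \<le> (\<Sum>j\<le>n b. exp (- s * (l * b)) * p ^ j)" .
    qed
    also have "\<dots> \<le> u' b"
    proof -
      have "(\<Sum>j\<le>n b. p ^ j) \<le> (\<Sum>j. p ^ j)"
        using p(2,3) by (intro sum_le_suminf summable_geometric) auto
      also have "\<dots> = 1 / (1 - p)" using p(2,3) by (intro suminf_geometric) auto
      finally have "exp (- s * (l * b)) * (\<Sum>j\<le>n b. p ^ j) \<le> exp (- s * (l * b)) * (1 / (1 - p))"
        by (intro mult_left_mono) auto
      then show ?thesis by (simp only: u'_def sum_distrib_left add_left_mono)
    qed
    finally have "1 / 2 \<le> measure N G"
      using half N.prob_compl[of G] G_M by (simp add: sets_N)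
    \<comment> \<open>Here \<open>Lambda \<beta> = 0\<close>, so on \<open>G\<close> the density of
      the tilt is at most \<open>exp (B b)\<close>; and \<open>G\<close> is an event of
      \<open>F (n b)\<close>, where this density is available.\<close>
    moreover have "measure N G \<le> exp (B b) * prob G"
    proof -
      have "emeasure N G = (\<integral>\<^sup>+\<omega>. indicator G \<omega> \<partial>N)" using G_M by (simp add: sets_N)
      also have "\<dots> = (\<integral>\<^sup>+\<omega>. ennreal (exp (\<beta> \<bullet> S (n b) \<omega> - real (n b) * real_of_ereal (Lambda \<beta>)))
          * indicator G \<omega> \<partial>M)"
        using G_F by (intro nn_integral_tilted N borel_measurable_indicator)
      also have "\<dots> \<le> (\<integral>\<^sup>+\<omega>. ennreal (exp (B b)) * indicator G \<omega> \<partial>M)"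
        by (intro nn_integral_mono)
          (auto simp: indicator_def G_def Lambda_eq[OF bp(1)] bp(2) ennreal_leI)
      also have "\<dots> = ennreal (exp (B b)) * emeasure M G"
        using G_M by (rule nn_integral_cmult_indicator)
      also have "\<dots> = ennreal (exp (B b) * prob G)"
        by (simp add: emeasure_eq_measure ennreal_mult)
      finally show ?thesis by (simp add: N.emeasure_eq_measure)
    qed
    moreover have "prob G \<le> prob (rare_event b)"
      using A by (intro finite_measure_mono rare_event_sets b subsetI rare_eventI)
        (auto simp: G_def hit_def)
    ultimately have "1 / 2 \<le> exp (B b) * prob (rare_event b)"
      by (meson exp_ge_zero mult_left_mono order_trans)
    then show ?thesis by (simp add: exp_minus field_simps)
  qed
  have "\<forall>\<^sub>F b in at_top. u' b < 1 / 2" using u'_lim by (rule order_tendstoD(2)) simp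
  then have "\<forall>\<^sub>F b in at_top. exp (- ((1 + \<epsilon>)\<^sup>2 * (\<beta> \<bullet> corner A) * b + (c + ln 2))) \<le> prob (rare_event b)"
    using eventually_gt_at_top[of 0]
  proof eventually_elim
    case (elim b)
    have "exp (- ((1 + \<epsilon>)\<^sup>2 * (\<beta> \<bullet> corner A) * b + (c + ln 2))) = exp (- B b - ln 2)"
      by (simp add: B_def \<rho>_def)
    also have "\<dots> = exp (- B b) / 2" by (simp only: exp_diff exp_ln zero_less_numeral)
    finally show ?case using bound[OF elim(2,1)] by simp
  qed
  then show ?thesis by (rule that)
qed

end

section \<open>Second moment under the mixture\<close>

context random_walk
begin

lemma tilted_sets: "is_tilted \<theta> N \<Longrightarrow> sets N = sets M"
  by (simp add: is_tilted_def)

lemma tilted_space: "is_tilted \<theta> N \<Longrightarrow> space N = space M"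
  by (intro sets_eq_imp_space_eq tilted_sets)

text \<open>The density of the mixture with respect to \<open>M\<close> on \<open>F n\<close>; the
  estimator is its reciprocal at the exit time.\<close>

definition likelihood :: "(real ^ 'd) set \<Rightarrow> nat \<Rightarrow> 'a \<Rightarrow> real" where
  "likelihood \<Theta> n \<omega> = (\<Sum>\<theta>\<in>\<Theta>. exp (\<theta> \<bullet> S n \<omega> - real n * real_of_ereal (Lambda \<theta>))) / real (card \<Theta>)"

lemma likelihood_pos: "finite \<Theta> \<Longrightarrow> \<Theta> \<noteq> {} \<Longrightarrow> likelihood \<Theta> n \<omega> > 0"
  unfolding likelihood_def by (intro divide_pos_pos sum_pos) (auto simp: card_gt_0_iff)

lemma likelihood_measurable_F: "likelihood \<Theta> n \<in> borel_measurable (F n)"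
  unfolding likelihood_def[abs_def] using S_measurable_F[of n n] by measurable

text \<open>All summands of the likelihood are positive, so keeping only the one for \<theta> bounds
  it from below.\<close>

lemma inverse_likelihood_le:
  assumes "finite \<Theta>" "\<theta> \<in> \<Theta>"
  shows "1 / likelihood \<Theta> n \<omega> \<le> real (card \<Theta>) * exp (real n * real_of_ereal (Lambda \<theta>) - \<theta> \<bullet> S n \<omega>)"
proof -
  let ?e = "\<lambda>\<theta>. exp (\<theta> \<bullet> S n \<omega> - real n * real_of_ereal (Lambda \<theta>))"
  have "?e \<theta> \<le> (\<Sum>\<theta>\<in>\<Theta>. ?e \<theta>)" using assms by (intro member_le_sum) auto
  then have "real (card \<Theta>) / (\<Sum>\<theta>\<in>\<Theta>. ?e \<theta>) \<le> real (card \<Theta>) / ?e \<theta>"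
    by (intro divide_left_mono mult_pos_pos exp_gt_zero less_le_trans[OF exp_gt_zero]) auto
  also have "\<dots> = real (card \<Theta>) * exp (real n * real_of_ereal (Lambda \<theta>) - \<theta> \<bullet> S n \<omega>)"
    by (simp add: exp_diff)
  finally show ?thesis by (simp add: likelihood_def)
qed

section \<open>The mixture measure and its density on \<open>F n\<close>\<close>

context
  fixes Q :: "real ^ 'd \<Rightarrow> 'a measure" and \<Theta> :: "(real ^ 'd) set"
  assumes fin: "finite \<Theta>" and ne: "\<Theta> \<noteq> {}" and tilted: "\<And>\<theta>. \<theta> \<in> \<Theta> \<Longrightarrow> is_tilted \<theta> (Q \<theta>)"
begin

lemma card_pos: "card \<Theta> > 0" using fin ne by (simp add: card_gt_0_iff)

lemma sets_mixture: "sets (mixture Q \<Theta>) = sets M" and space_mixture: "space (mixture Q \<Theta>) = space M"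
  by (simp_all add: mixture_def space_measure_of_conv)

text \<open>The function given to \<open>measure_of\<close> has to be shown countably additive
  before the measure is known to take its values; the finite sum over \<open>\<Theta>\<close> is
  exchanged with the series.\<close>

lemma emeasure_mixture:
  assumes B: "B \<in> sets M"
  shows "emeasure (mixture Q \<Theta>) B = (\<Sum>\<theta>\<in>\<Theta>. emeasure (Q \<theta>) B) / of_nat (card \<Theta>)"
proof (rule emeasure_measure_of[OF mixture_def])
  show "sets M \<subseteq> Pow (space M)" by (rule sets.space_closed)
  show "B \<in> sets (mixture Q \<Theta>)" using B by (simp add: sets_mixture)
  show "positive (sets (mixture Q \<Theta>)) (\<lambda>B. (\<Sum>\<theta>\<in>\<Theta>. emeasure (Q \<theta>) B) / of_nat (card \<Theta>))"
    by (simp add: positive_def)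
  show "countably_additive (sets (mixture Q \<Theta>)) (\<lambda>B. (\<Sum>\<theta>\<in>\<Theta>. emeasure (Q \<theta>) B) / of_nat (card \<Theta>))"
  proof (rule countably_additiveI)
    fix A :: "nat \<Rightarrow> 'a set" assume A: "range A \<subseteq> sets (mixture Q \<Theta>)" "disjoint_family A"
    have "(\<Sum>i. (\<Sum>\<theta>\<in>\<Theta>. emeasure (Q \<theta>) (A i)) / of_nat (card \<Theta>))
        = (\<Sum>i. (\<Sum>\<theta>\<in>\<Theta>. emeasure (Q \<theta>) (A i))) / of_nat (card \<Theta>)"
      by (simp add: divide_ennreal_def)
    also have "(\<Sum>i. (\<Sum>\<theta>\<in>\<Theta>. emeasure (Q \<theta>) (A i))) = (\<Sum>\<theta>\<in>\<Theta>. \<Sum>i. emeasure (Q \<theta>) (A i))"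
      by (rule suminf_sum) simp
    also have "\<dots> = (\<Sum>\<theta>\<in>\<Theta>. emeasure (Q \<theta>) (\<Union> (range A)))"
      using A by (intro sum.cong refl suminf_emeasure) (simp_all add: sets_mixture tilted_sets[OF tilted])
    finally show "(\<Sum>i. (\<Sum>\<theta>\<in>\<Theta>. emeasure (Q \<theta>) (A i)) / of_nat (card \<Theta>))
        = (\<Sum>\<theta>\<in>\<Theta>. emeasure (Q \<theta>) (\<Union> (range A))) / of_nat (card \<Theta>)" .
  qed
qed

lemma prob_space_mixture: "prob_space (mixture Q \<Theta>)"
proof (rule prob_spaceI)
  have "emeasure (Q \<theta>) (space M) = 1" if "\<theta> \<in> \<Theta>" for \<theta>
    using prob_space.emeasure_space_1[of "Q \<theta>"] tilted[OF that] tilted_space[OF tilted[OF that]]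
    by (simp add: is_tilted_def)
  then show "emeasure (mixture Q \<Theta>) (space (mixture Q \<Theta>)) = 1"
    using card_pos by (simp add: space_mixture emeasure_mixture ennreal_of_nat_eq_real_of_nat divide_ennreal)
qed

text \<open>Averaging the densities of the single tilts gives the density of the mixture; it is
  checked on events of \<open>F n\<close> and then extended to integrals.\<close>

lemma nn_integral_mixture:
  assumes f: "f \<in> borel_measurable (F n)"
  shows "(\<integral>\<^sup>+\<omega>. f \<omega> \<partial>mixture Q \<Theta>) = (\<integral>\<^sup>+\<omega>. ennreal (likelihood \<Theta> n \<omega>) * f \<omega> \<partial>M)"
proof (rule nn_integral_density_restr[OF subalgebra_F _ _ _ f])
  show L: "(\<lambda>\<omega>. ennreal (likelihood \<Theta> n \<omega>)) \<in> borel_measurable (F n)"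
    using likelihood_measurable_F by measurable
  show sub: "subalgebra (mixture Q \<Theta>) (F n)"
    using subalgebra_F by (simp add: subalgebra_def sets_mixture space_mixture)
  show "restr_to_subalg (mixture Q \<Theta>) (F n) = density (restr_to_subalg M (F n)) (\<lambda>\<omega>. ennreal (likelihood \<Theta> n \<omega>))"
  proof (rule measure_eqI)
    show "sets (restr_to_subalg (mixture Q \<Theta>) (F n))
        = sets (density (restr_to_subalg M (F n)) (\<lambda>\<omega>. ennreal (likelihood \<Theta> n \<omega>)))"
      by (simp add: sets_restr_to_subalg[OF sub] sets_restr_to_subalg[OF subalgebra_F])
    fix B assume "B \<in> sets (restr_to_subalg (mixture Q \<Theta>) (F n))"
    then have B: "B \<in> sets (F n)" by (simp add: sets_restr_to_subalg[OF sub])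
    then have BM [measurable]: "B \<in> sets M" using subalgebra_F by (auto simp: subalgebra_def)
    have [measurable]: "S n \<in> borel_measurable M" by (rule S_measurable)
    let ?e = "\<lambda>\<theta> \<omega>. ennreal (exp (\<theta> \<bullet> S n \<omega> - real n * real_of_ereal (Lambda \<theta>)))"
    have "emeasure (restr_to_subalg (mixture Q \<Theta>) (F n)) B = (\<Sum>\<theta>\<in>\<Theta>. emeasure (Q \<theta>) B) / of_nat (card \<Theta>)"
      by (simp add: emeasure_restr_to_subalg[OF sub B] emeasure_mixture BM)
    also have "(\<Sum>\<theta>\<in>\<Theta>. emeasure (Q \<theta>) B) = (\<Sum>\<theta>\<in>\<Theta>. \<integral>\<^sup>+\<omega>. ?e \<theta> \<omega> * indicator B \<omega> \<partial>M)"
    proof (rule sum.cong)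
      fix \<theta> assume \<theta>: "\<theta> \<in> \<Theta>"
      have "emeasure (Q \<theta>) B = (\<integral>\<^sup>+\<omega>. indicator B \<omega> \<partial>Q \<theta>)"
        using BM by (simp add: tilted_sets[OF tilted[OF \<theta>]])
      also have "\<dots> = (\<integral>\<^sup>+\<omega>. ?e \<theta> \<omega> * indicator B \<omega> \<partial>M)"
        using B by (intro nn_integral_tilted tilted \<theta> borel_measurable_indicator)
      finally show "emeasure (Q \<theta>) B = (\<integral>\<^sup>+\<omega>. ?e \<theta> \<omega> * indicator B \<omega> \<partial>M)" .
    qed simp
    also have "\<dots> = (\<integral>\<^sup>+\<omega>. (\<Sum>\<theta>\<in>\<Theta>. ?e \<theta> \<omega> * indicator B \<omega>) \<partial>M)"
      by (intro nn_integral_sum[symmetric]) measurable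
    also have "\<dots> / of_nat (card \<Theta>) = (\<integral>\<^sup>+\<omega>. (\<Sum>\<theta>\<in>\<Theta>. ?e \<theta> \<omega> * indicator B \<omega>) / of_nat (card \<Theta>) \<partial>M)"
      by (intro nn_integral_divide[symmetric]) measurable
    also have "\<dots> = (\<integral>\<^sup>+\<omega>. ennreal (likelihood \<Theta> n \<omega>) * indicator B \<omega> \<partial>M)"
      using card_pos
      by (intro nn_integral_cong)
        (simp add: likelihood_def indicator_def sum_nonneg flip: sum_ennreal divide_ennreal ennreal_of_nat_eq_real_of_nat)
    also have "\<dots> = (\<integral>\<^sup>+\<omega>. ennreal (likelihood \<Theta> n \<omega>) * indicator B \<omega> \<partial>restr_to_subalg M (F n))"
    proof (intro nn_integral_subalgebra2[symmetric] subalgebra_F)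
      note [measurable] = L B
      show "(\<lambda>\<omega>. ennreal (likelihood \<Theta> n \<omega>) * indicator B \<omega>) \<in> borel_measurable (F n)" by measurable
    qed
    also have "\<dots> = emeasure (density (restr_to_subalg M (F n)) (\<lambda>\<omega>. ennreal (likelihood \<Theta> n \<omega>))) B"
      using B by (intro emeasure_density[symmetric] measurable_in_subalg subalgebra_F L)
        (simp add: sets_restr_to_subalg[OF subalgebra_F])
    finally show "emeasure (restr_to_subalg (mixture Q \<Theta>) (F n)) B
        = emeasure (density (restr_to_subalg M (F n)) (\<lambda>\<omega>. ennreal (likelihood \<Theta> n \<omega>))) B" .
  qed
qed

end

end

section \<open>Moments of the importance sampling estimator\<close>

context siegmund
begin

lemma W_hat_exit_at:
  assumes "\<omega> \<in> exit_at b n"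
  shows "W_hat b \<Theta> \<omega> = 1 / likelihood \<Theta> n \<omega>"
  using exit_at_tau[OF assms] by (simp add: W_hat_def likelihood_def field_simps)

lemma W_hat_nonneg: "W_hat b \<Theta> \<omega> \<ge> 0"
  unfolding W_hat_def Let_def
  by (intro mult_nonneg_nonneg inverse_nonnegative_iff_nonnegative[THEN iffD2] sum_nonneg) simp_all

text \<open>The exit events are disjoint, so at most one term is nonzero. Off the rare event both
  sides vanish, which for the left side relies on \<open>p > 0\<close>.\<close>

lemma W_hat_power_eq:
  assumes "\<omega> \<in> space M" "p > 0"
  shows "ennreal (W_hat b \<Theta> \<omega> ^ p) = (\<Sum>n. ennreal ((1 / likelihood \<Theta> n \<omega>) ^ p) * indicator (exit_at b n) \<omega>)"
proof (cases "\<omega> \<in> rare_event b")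
  case True
  then obtain m where m: "\<omega> \<in> exit_at b m" by (auto simp: rare_event_eq)
  have "\<omega> \<notin> exit_at b n" if "n \<noteq> m" for n
    using disjoint_exit_at[of b] m that by (auto simp: disjoint_family_on_def)
  then have "(\<Sum>n. ennreal ((1 / likelihood \<Theta> n \<omega>) ^ p) * indicator (exit_at b n) \<omega>)
      = (\<Sum>n\<in>{m}. ennreal ((1 / likelihood \<Theta> n \<omega>) ^ p) * indicator (exit_at b n) \<omega>)"
    by (intro suminf_finite) auto
  then show ?thesis using m by (simp add: W_hat_exit_at[OF m])
next
  case False
  then have "\<omega> \<notin> exit_at b n" for n by (auto simp: rare_event_eq)
  moreover have "W_hat b \<Theta> \<omega> = 0"
    using False assms(1) by (simp add: W_hat_def rare_event_def Let_def)
  ultimately show ?thesis using assms(2) by simp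
qed

context
  fixes Q :: "real ^ 'd \<Rightarrow> 'a measure" and \<Theta> :: "(real ^ 'd) set" and b :: real
  assumes fin: "finite \<Theta>" and ne: "\<Theta> \<noteq> {}" and tilted: "\<And>\<theta>. \<theta> \<in> \<Theta> \<Longrightarrow> is_tilted \<theta> (Q \<theta>)"
    and b: "b > 0"
begin

lemma term_measurable_F:
  "(\<lambda>\<omega>. ennreal ((1 / likelihood \<Theta> n \<omega>) ^ p) * indicator (exit_at b n) \<omega>) \<in> borel_measurable (F n)"
  using likelihood_measurable_F[of \<Theta> n] exit_at_sets[OF b, of n] by measurable

lemma term_measurable:
  "(\<lambda>\<omega>. ennreal ((1 / likelihood \<Theta> n \<omega>) ^ p) * indicator (exit_at b n) \<omega>) \<in> borel_measurable M"
  by (rule measurable_from_subalg[OF subalgebra_F term_measurable_F])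

lemma W_hat_measurable: "W_hat b \<Theta> \<in> borel_measurable (mixture Q \<Theta>)"
proof -
  have "(\<lambda>\<omega>. enn2real (\<Sum>n. ennreal ((1 / likelihood \<Theta> n \<omega>) ^ 1) * indicator (exit_at b n) \<omega>))
      \<in> borel_measurable M"
    using term_measurable[of _ 1] by measurable
  also have "?this \<longleftrightarrow> W_hat b \<Theta> \<in> borel_measurable M"
  proof (intro measurable_cong)
    fix \<omega> assume "\<omega> \<in> space M"
    then have "(\<Sum>n. ennreal ((1 / likelihood \<Theta> n \<omega>) ^ 1) * indicator (exit_at b n) \<omega>) = ennreal (W_hat b \<Theta> \<omega> ^ 1)"
      by (intro W_hat_power_eq[symmetric]) auto
    then show "enn2real (\<Sum>n. ennreal ((1 / likelihood \<Theta> n \<omega>) ^ 1) * indicator (exit_at b n) \<omega>) = W_hat b \<Theta> \<omega>"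
      by (simp add: W_hat_nonneg)
  qed
  finally show ?thesis
    by (simp add: measurable_cong_sets[OF sets_mixture[OF fin ne tilted] refl])
qed

text \<open>On each exit event the density of the mixture cancels one power of the weight. The case
  \<open>p = 1\<close> is unbiasedness; the case \<open>p = 2\<close> leaves a single weight
  integrated under \<open>M\<close>.\<close>

lemma nn_integral_W_hat_power:
  assumes "p > 0"
  shows "(\<integral>\<^sup>+\<omega>. ennreal (W_hat b \<Theta> \<omega> ^ p) \<partial>mixture Q \<Theta>)
    = (\<Sum>n. \<integral>\<^sup>+\<omega>. ennreal ((1 / likelihood \<Theta> n \<omega>) ^ (p - 1)) * indicator (exit_at b n) \<omega> \<partial>M)"
proof -
  have "(\<integral>\<^sup>+\<omega>. ennreal (W_hat b \<Theta> \<omega> ^ p) \<partial>mixture Q \<Theta>)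
      = (\<integral>\<^sup>+\<omega>. (\<Sum>n. ennreal ((1 / likelihood \<Theta> n \<omega>) ^ p) * indicator (exit_at b n) \<omega>) \<partial>mixture Q \<Theta>)"
    using assms by (intro nn_integral_cong W_hat_power_eq) (auto simp: space_mixture[OF fin ne tilted])
  also have "\<dots> = (\<Sum>n. \<integral>\<^sup>+\<omega>. ennreal ((1 / likelihood \<Theta> n \<omega>) ^ p) * indicator (exit_at b n) \<omega> \<partial>mixture Q \<Theta>)"
    using term_measurable
    by (intro nn_integral_suminf) (simp add: measurable_cong_sets[OF sets_mixture[OF fin ne tilted] refl])
  also have "\<dots> = (\<Sum>n. \<integral>\<^sup>+\<omega>. ennreal ((1 / likelihood \<Theta> n \<omega>) ^ (p - 1)) * indicator (exit_at b n) \<omega> \<partial>M)"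
  proof (rule suminf_cong)
    fix n
    have "likelihood \<Theta> n \<omega> * (1 / likelihood \<Theta> n \<omega>) ^ p = (1 / likelihood \<Theta> n \<omega>) ^ (p - 1)" for \<omega>
      using likelihood_pos[OF fin ne, of n \<omega>] assms by (cases p) auto
    then have "ennreal (likelihood \<Theta> n \<omega>) * (ennreal ((1 / likelihood \<Theta> n \<omega>) ^ p) * indicator (exit_at b n) \<omega>)
        = ennreal ((1 / likelihood \<Theta> n \<omega>) ^ (p - 1)) * indicator (exit_at b n) \<omega>" for \<omega>
      using likelihood_pos[OF fin ne, of n \<omega>]
      by (simp add: mult.assoc[symmetric] ennreal_mult[symmetric] del: power_one_over)
    then show "(\<integral>\<^sup>+\<omega>. ennreal ((1 / likelihood \<Theta> n \<omega>) ^ p) * indicator (exit_at b n) \<omega> \<partial>mixture Q \<Theta>)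
        = (\<integral>\<^sup>+\<omega>. ennreal ((1 / likelihood \<Theta> n \<omega>) ^ (p - 1)) * indicator (exit_at b n) \<omega> \<partial>M)"
      by (simp only: nn_integral_mixture[OF fin ne tilted term_measurable_F])
  qed
  finally show ?thesis .
qed

lemma first_moment: "(\<integral>\<^sup>+\<omega>. ennreal (W_hat b \<Theta> \<omega>) \<partial>mixture Q \<Theta>) = ennreal (prob (rare_event b))"
proof -
  have sets: "exit_at b n \<in> sets M" for n
    using exit_at_sets[OF b] subalgebra_F by (auto simp: subalgebra_def)
  have "(\<integral>\<^sup>+\<omega>. ennreal (W_hat b \<Theta> \<omega>) \<partial>mixture Q \<Theta>) = (\<Sum>n. emeasure M (exit_at b n))"
    using nn_integral_W_hat_power[of 1] sets by simp
  also have "\<dots> = emeasure M (rare_event b)"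
    unfolding rare_event_eq using sets disjoint_exit_at by (intro suminf_emeasure) auto
  finally show ?thesis by (simp add: emeasure_eq_measure)
qed

lemma second_moment_le:
  assumes *: "\<And>A. A \<noteq> {} \<Longrightarrow> \<theta> A \<in> \<Theta>" "\<And>A. A \<noteq> {} \<Longrightarrow> Lambda (\<theta> A) \<le> 0"
      "\<And>A. A \<noteq> {} \<Longrightarrow> Lambda (\<eta> A) \<le> 0" "\<And>A. A \<noteq> {} \<Longrightarrow> is_tilted (\<eta> A) (Q (\<eta> A))"
      "\<And>A k. A \<noteq> {} \<Longrightarrow> orient A k * \<theta> A $ k \<ge> 0" "\<And>A k. A \<noteq> {} \<Longrightarrow> orient A k * \<eta> A $ k \<ge> 0"
      "\<And>A. A \<noteq> {} \<Longrightarrow> 2 * \<rho> \<le> \<theta> A \<bullet> corner A + \<eta> A \<bullet> corner A"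
  shows "(\<integral>\<^sup>+\<omega>. ennreal ((W_hat b \<Theta> \<omega>)\<^sup>2) \<partial>mixture Q \<Theta>)
    \<le> ennreal (real (card {A :: 'd set. A \<noteq> {}}) * real (card \<Theta>) * exp (- (2 * \<rho> * b)))"
proof -
  define C where "C = real (card \<Theta>) * exp (- (2 * \<rho> * b))"
  have C: "C \<ge> 0" by (simp add: C_def)
  let ?A = "{A :: 'd set. A \<noteq> {}}"
  let ?e = "\<lambda>A n \<omega>. exp (\<eta> A \<bullet> S n \<omega> - real n * real_of_ereal (Lambda (\<eta> A)))"
  have exit_sets: "exit_at b n \<in> sets M" for n
    using exit_at_sets[OF b] subalgebra_F by (auto simp: subalgebra_def)
  \<comment> \<open>The orthant that is hit depends on \<omega>; summing over all nonempty
    \<open>A\<close> makes the bound uniform.\<close>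
  have pointwise: "1 / likelihood \<Theta> n \<omega> \<le> (\<Sum>A\<in>?A. C * ?e A n \<omega>)" if "\<omega> \<in> exit_at b n" for n \<omega>
  proof -
    have "hit b n \<omega>" using \<open>\<omega> \<in> exit_at b n\<close> by (simp add: exit_at_def)
    then obtain A where A: "A \<noteq> {}" and S: "S n \<omega> \<in> (*\<^sub>R) b ` W l u A"
      unfolding hit_def by (elim exE conjE) (rule that)
    have "real n * real_of_ereal (Lambda (\<theta> A)) \<le> 0"
      using *(2)[OF A] by (cases "Lambda (\<theta> A)") (auto simp: mult_nonneg_nonpos)
    moreover have "real n * real_of_ereal (Lambda (\<eta> A)) \<le> 0"
      using *(3)[OF A] by (cases "Lambda (\<eta> A)") (auto simp: mult_nonneg_nonpos)
    moreover have "b * (2 * \<rho>) \<le> b * (\<theta> A \<bullet> corner A + \<eta> A \<bullet> corner A)"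
      using *(7)[OF A] b by (intro mult_left_mono) auto
    moreover have "b * (\<theta> A \<bullet> corner A) \<le> \<theta> A \<bullet> S n \<omega>" "b * (\<eta> A \<bullet> corner A) \<le> \<eta> A \<bullet> S n \<omega>"
      by (rule inner_corner_le_scaled_W[OF b *(5)[OF A] S], rule inner_corner_le_scaled_W[OF b *(6)[OF A] S])
    ultimately have "real n * real_of_ereal (Lambda (\<theta> A)) - \<theta> A \<bullet> S n \<omega>
        \<le> - (2 * \<rho> * b) + (\<eta> A \<bullet> S n \<omega> - real n * real_of_ereal (Lambda (\<eta> A)))"
      by (simp add: algebra_simps)
    then have "exp (real n * real_of_ereal (Lambda (\<theta> A)) - \<theta> A \<bullet> S n \<omega>) \<le> exp (- (2 * \<rho> * b)) * ?e A n \<omega>"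
      unfolding exp_add[symmetric] by simp
    then have "1 / likelihood \<Theta> n \<omega> \<le> C * ?e A n \<omega>"
      using inverse_likelihood_le[OF fin *(1)[OF A], of n \<omega>]
      unfolding C_def mult.assoc by (meson mult_left_mono of_nat_0_le_iff order_trans)
    also have "\<dots> \<le> (\<Sum>A\<in>?A. C * ?e A n \<omega>)"
      using A C by (intro member_le_sum[where f="\<lambda>A. C * ?e A n \<omega>"]) auto
    finally show ?thesis .
  qed
  have "(\<integral>\<^sup>+\<omega>. ennreal ((W_hat b \<Theta> \<omega>)\<^sup>2) \<partial>mixture Q \<Theta>)
      = (\<Sum>n. \<integral>\<^sup>+\<omega>. ennreal (1 / likelihood \<Theta> n \<omega>) * indicator (exit_at b n) \<omega> \<partial>M)"
    using nn_integral_W_hat_power[of 2] by simp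
  also have "\<dots> \<le> (\<Sum>n. \<Sum>A\<in>?A. ennreal C * emeasure (Q (\<eta> A)) (exit_at b n))"
  proof (intro suminf_le)
    fix n
    have "(\<integral>\<^sup>+\<omega>. ennreal (1 / likelihood \<Theta> n \<omega>) * indicator (exit_at b n) \<omega> \<partial>M)
        \<le> (\<integral>\<^sup>+\<omega>. (\<Sum>A\<in>?A. ennreal C * (ennreal (?e A n \<omega>) * indicator (exit_at b n) \<omega>)) \<partial>M)"
    proof (intro nn_integral_mono)
      fix \<omega>
      show "ennreal (1 / likelihood \<Theta> n \<omega>) * indicator (exit_at b n) \<omega>
          \<le> (\<Sum>A\<in>?A. ennreal C * (ennreal (?e A n \<omega>) * indicator (exit_at b n) \<omega>))"
      proof (cases "\<omega> \<in> exit_at b n")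
        case True
        have "ennreal (1 / likelihood \<Theta> n \<omega>) \<le> ennreal (\<Sum>A\<in>?A. C * ?e A n \<omega>)"
          by (intro ennreal_leI pointwise True)
        also have "\<dots> = (\<Sum>A\<in>?A. ennreal C * ennreal (?e A n \<omega>))"
          using C by (simp add: ennreal_mult flip: sum_ennreal)
        finally show ?thesis using True by simp
      qed simp
    qed
    also have "\<dots> = (\<Sum>A\<in>?A. ennreal C * (\<integral>\<^sup>+\<omega>. ennreal (?e A n \<omega>) * indicator (exit_at b n) \<omega> \<partial>M))"
      using exit_sets[of n] S_measurable[of n]
      by (simp add: nn_integral_sum nn_integral_cmult)
    also have "\<dots> = (\<Sum>A\<in>?A. ennreal C * emeasure (Q (\<eta> A)) (exit_at b n))"
    proof (rule sum.cong)
      fix A :: "'d set" assume "A \<in> ?A"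
      then have A: "A \<noteq> {}" by simp
      have "emeasure (Q (\<eta> A)) (exit_at b n) = (\<integral>\<^sup>+\<omega>. indicator (exit_at b n) \<omega> \<partial>Q (\<eta> A))"
        using exit_sets by (simp add: tilted_sets[OF *(4)[OF A]])
      also have "\<dots> = (\<integral>\<^sup>+\<omega>. ennreal (?e A n \<omega>) * indicator (exit_at b n) \<omega> \<partial>M)"
        using exit_at_sets[OF b] A by (intro nn_integral_tilted * borel_measurable_indicator)
      finally show "ennreal C * (\<integral>\<^sup>+\<omega>. ennreal (?e A n \<omega>) * indicator (exit_at b n) \<omega> \<partial>M)
          = ennreal C * emeasure (Q (\<eta> A)) (exit_at b n)" by simp
    qed simp
    finally show "(\<integral>\<^sup>+\<omega>. ennreal (1 / likelihood \<Theta> n \<omega>) * indicator (exit_at b n) \<omega> \<partial>M)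
        \<le> (\<Sum>A\<in>?A. ennreal C * emeasure (Q (\<eta> A)) (exit_at b n))" .
  qed simp_all
  also have "\<dots> = (\<Sum>A\<in>?A. \<Sum>n. ennreal C * emeasure (Q (\<eta> A)) (exit_at b n))"
    by (rule suminf_sum) simp
  also have "\<dots> \<le> (\<Sum>A\<in>?A. ennreal C)"
  proof (rule sum_mono)
    fix A :: "'d set" assume "A \<in> ?A"
    then have A: "A \<noteq> {}" by simp
    interpret QA: prob_space "Q (\<eta> A)" using *(4)[OF A] by (simp add: is_tilted_def)
    have "(\<Sum>n. ennreal C * emeasure (Q (\<eta> A)) (exit_at b n))
        = ennreal C * (\<Sum>n. emeasure (Q (\<eta> A)) (exit_at b n))" by simp
    also have "(\<Sum>n. emeasure (Q (\<eta> A)) (exit_at b n)) = emeasure (Q (\<eta> A)) (\<Union>n. exit_at b n)"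
      using exit_sets disjoint_exit_at by (intro suminf_emeasure) (auto simp: tilted_sets[OF *(4)[OF A]])
    also have "ennreal C * \<dots> \<le> ennreal C * 1"
      by (intro mult_left_mono QA.measure_le_1) simp
    finally show "(\<Sum>n. ennreal C * emeasure (Q (\<eta> A)) (exit_at b n)) \<le> ennreal C" by simp
  qed
  also have "\<dots> = ennreal (real (card ?A) * C)"
    using C by (simp add: ennreal_mult ennreal_of_nat_eq_real_of_nat)
  finally show ?thesis by (simp add: C_def mult.assoc)
qed

end

end

section \<open>Asymptotic efficiency\<close>

lemma (in prob_space) square_expectation_le:
  fixes f :: "'a \<Rightarrow> real"
  assumes "integrable M f" "integrable M (\<lambda>x. (f x)\<^sup>2)"
  shows "(expectation f)\<^sup>2 \<le> expectation (\<lambda>x. (f x)\<^sup>2)"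
  using variance_eq[OF assms] variance_positive[of f] by simp

context siegmund
begin

text \<open>The feasible set of the dual problem whose objective
  \<open>\<theta> \<bullet> corner A\<close> bounds \<open>r A\<close> from below.\<close>

definition dual_feasible :: "'d set \<Rightarrow> real ^ 'd \<Rightarrow> bool" where
  "dual_feasible A \<theta> \<longleftrightarrow> Lambda \<theta> \<le> 0 \<and> (\<forall>k. orient A k * \<theta> $ k \<ge> 0)"

lemma dual_feasible_le_r: "dual_feasible A \<theta> \<Longrightarrow> ereal (\<theta> \<bullet> corner A) \<le> r A"
  by (auto simp: dual_feasible_def intro: inner_corner_le_r)

text \<open>Only the first vector of the pair must belong to \<open>\<Theta>\<close>. Under (H1) the
  second one may be a \<gamma> for two coordinates, which need not occur in the family.\<close>

definition covers :: "(real ^ 'd) set \<Rightarrow> real \<Rightarrow> bool" where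
  "covers \<Theta> \<rho> \<longleftrightarrow> (\<forall>A. A \<noteq> {} \<longrightarrow> (\<exists>\<theta> \<eta>. \<theta> \<in> \<Theta> \<and> dual_feasible A \<theta> \<and> dual_feasible A \<eta> \<and>
     2 * \<rho> \<le> \<theta> \<bullet> corner A + \<eta> \<bullet> corner A))"

text \<open>One of the two vectors has a value of at least the average \<rho>, and weak duality
  applies to it.\<close>

lemma covers_le_r_star:
  assumes "covers \<Theta> \<rho>"
  shows "ereal \<rho> \<le> r_star"
  unfolding r_star_def
proof (rule INF_greatest)
  fix A :: "'d set" assume "A \<in> {A. A \<noteq> {}}"
  then have "A \<noteq> {}" by simp
  then obtain \<theta> \<eta> where *: "dual_feasible A \<theta>" "dual_feasible A \<eta>"
      "2 * \<rho> \<le> \<theta> \<bullet> corner A + \<eta> \<bullet> corner A"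
    using assms unfolding covers_def by blast
  show "ereal \<rho> \<le> r A"
  proof (cases "\<rho> \<le> \<theta> \<bullet> corner A")
    case True
    then show ?thesis using dual_feasible_le_r[OF *(1)] by (meson ereal_less_eq(3) order_trans)
  next
    case False
    then have "\<rho> \<le> \<eta> \<bullet> corner A" using *(3) by linarith
    then show ?thesis using dual_feasible_le_r[OF *(2)] by (meson ereal_less_eq(3) order_trans)
  qed
qed

context
  fixes Q :: "real ^ 'd \<Rightarrow> 'a measure" and \<Theta> :: "(real ^ 'd) set" and \<rho> :: real
  assumes Q: "\<And>\<theta>. \<theta> \<in> edom Lambda \<Longrightarrow> is_tilted \<theta> (Q \<theta>)"
    and fin: "finite \<Theta>" and dom: "\<Theta> \<subseteq> edom Lambda" and cov: "covers \<Theta> \<rho>"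
begin

lemma nonempty: "\<Theta> \<noteq> {}"
  using cov unfolding covers_def by blast

lemma tilted: "\<theta> \<in> \<Theta> \<Longrightarrow> is_tilted \<theta> (Q \<theta>)"
  using Q dom by blast

text \<open>The uniform estimate makes the squared weight integrable, and Jensen's inequality with
  the unbiased first moment gives the lower bound.\<close>

lemma moments:
  assumes b: "b > 0"
  shows "integrable (mixture Q \<Theta>) (\<lambda>\<omega>. (W_hat b \<Theta> \<omega>)\<^sup>2)"
    and "(\<integral>\<omega>. (W_hat b \<Theta> \<omega>)\<^sup>2 \<partial>mixture Q \<Theta>)
      \<le> real (card {A :: 'd set. A \<noteq> {}}) * real (card \<Theta>) * exp (- (2 * \<rho> * b))"
    and "(prob (rare_event b))\<^sup>2 \<le> (\<integral>\<omega>. (W_hat b \<Theta> \<omega>)\<^sup>2 \<partial>mixture Q \<Theta>)"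
proof -
  interpret mix: prob_space "mixture Q \<Theta>" by (rule prob_space_mixture[OF fin nonempty tilted])
  have meas [measurable]: "W_hat b \<Theta> \<in> borel_measurable (mixture Q \<Theta>)"
    by (rule W_hat_measurable[OF fin nonempty tilted b])
  have "\<forall>A. \<exists>p. A \<noteq> {} \<longrightarrow> fst p \<in> \<Theta> \<and> dual_feasible A (fst p) \<and> dual_feasible A (snd p) \<and>
     2 * \<rho> \<le> fst p \<bullet> corner A + snd p \<bullet> corner A"
    using cov unfolding covers_def by auto
  from choice[OF this] obtain p where "\<forall>A. A \<noteq> {} \<longrightarrow> fst (p A) \<in> \<Theta> \<and> dual_feasible A (fst (p A)) \<and>
      dual_feasible A (snd (p A)) \<and> 2 * \<rho> \<le> fst (p A) \<bullet> corner A + snd (p A) \<bullet> corner A"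
    by (elim exE)
  then have p: "fst (p A) \<in> \<Theta> \<and> dual_feasible A (fst (p A)) \<and>
      dual_feasible A (snd (p A)) \<and> 2 * \<rho> \<le> fst (p A) \<bullet> corner A + snd (p A) \<bullet> corner A"
    if "A \<noteq> {}" for A using that by simp
  have le: "(\<integral>\<^sup>+\<omega>. ennreal ((W_hat b \<Theta> \<omega>)\<^sup>2) \<partial>mixture Q \<Theta>)
    \<le> ennreal (real (card {A :: 'd set. A \<noteq> {}}) * real (card \<Theta>) * exp (- (2 * \<rho> * b)))"
  proof (rule second_moment_le[OF fin nonempty tilted b, where \<theta>="\<lambda>A. fst (p A)" and \<eta>="\<lambda>A. snd (p A)"])
    show "is_tilted (snd (p A)) (Q (snd (p A)))" if "A \<noteq> {}" for A
      using p[OF that] by (intro Q) (auto simp: dual_feasible_def Lambda_le_0_iff)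
  qed (use p in \<open>auto simp: dual_feasible_def\<close>)
  show int2: "integrable (mixture Q \<Theta>) (\<lambda>\<omega>. (W_hat b \<Theta> \<omega>)\<^sup>2)"
    using le by (intro integrableI_nonneg) (auto intro: le_less_trans)
  then show "(\<integral>\<omega>. (W_hat b \<Theta> \<omega>)\<^sup>2 \<partial>mixture Q \<Theta>)
      \<le> real (card {A :: 'd set. A \<noteq> {}}) * real (card \<Theta>) * exp (- (2 * \<rho> * b))"
    using le by (simp add: nn_integral_eq_integral)
  have int1: "integrable (mixture Q \<Theta>) (W_hat b \<Theta>)"
    using first_moment[OF fin nonempty tilted b] by (intro integrableI_nonneg) (auto simp: W_hat_nonneg)
  have "(\<integral>\<omega>. W_hat b \<Theta> \<omega> \<partial>mixture Q \<Theta>) = prob (rare_event b)"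
    using first_moment[OF fin nonempty tilted b] nn_integral_eq_integral[OF int1]
    by (simp add: W_hat_nonneg integral_nonneg_AE)
  then show "(prob (rare_event b))\<^sup>2 \<le> (\<integral>\<omega>. (W_hat b \<Theta> \<omega>)\<^sup>2 \<partial>mixture Q \<Theta>)"
    using mix.square_expectation_le[OF int1 int2] by simp
qed

text \<open>Jensen's inequality bounds the ratio of logarithms by 1 from above. From below, the
  second moment decays at rate \<open>2 * \<rho>\<close>, while the probability decays at a rate of
  at most \<open>(1 + \<epsilon>)\<^sup>2 * \<rho>\<close> for every positive \<epsilon>.\<close>

lemma covers_imp_asymptotically_efficient:
  assumes A: "A \<noteq> {}" and \<beta>: "is_beta A \<beta>" and \<rho>: "r A = ereal \<rho>"
  shows "asymptotically_efficient Q \<Theta>"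
proof -
  define m2 where "m2 b = (\<integral>\<omega>. (W_hat b \<Theta> \<omega>)\<^sup>2 \<partial>mixture Q \<Theta>)" for b
  define pr where "pr b = prob (rare_event b)" for b
  define C where "C = real (card {A :: 'd set. A \<noteq> {}}) * real (card \<Theta>)"
  have "card {A :: 'd set. A \<noteq> {}} > 0" using A by (auto simp: card_gt_0_iff)
  then have C: "C > 0" using fin nonempty by (simp add: C_def card_gt_0_iff)
  note bp = beta_properties[OF \<beta>]
  have \<rho>_eq: "\<beta> \<bullet> corner A = \<rho>" and \<rho>_pos: "\<rho> > 0"
    using bp(4) \<rho> r_pos[OF A] by auto
  have upper: "ln (m2 b) \<le> ln C - 2 * \<rho> * b" and jensen: "2 * ln (pr b) \<le> ln (m2 b)"
    if "b > 0" "pr b > 0" for b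
  proof -
    have sq: "(pr b)\<^sup>2 \<le> m2 b" and le: "m2 b \<le> C * exp (- (2 * \<rho> * b))"
      using moments(2,3)[OF that(1)] by (simp_all add: m2_def pr_def C_def)
    have m2: "m2 b > 0" using that(2) by (intro less_le_trans[OF _ sq]) simp
    have "ln (m2 b) \<le> ln (C * exp (- (2 * \<rho> * b)))" using le m2 C by (subst ln_le_cancel_iff) auto
    then show "ln (m2 b) \<le> ln C - 2 * \<rho> * b" using C by (simp add: ln_mult)
    have "ln ((pr b)\<^sup>2) \<le> ln (m2 b)" using sq m2 that(2) by (subst ln_le_cancel_iff) auto
    then show "2 * ln (pr b) \<le> ln (m2 b)" using that(2) by (simp add: ln_realpow)
  qed
  have lower: "\<exists>K. \<forall>\<^sub>F b in at_top. pr b > 0 \<and> - ln (pr b) \<le> (1 + \<epsilon>)\<^sup>2 * \<rho> * b + K" if \<epsilon>: "\<epsilon> > 0" for \<epsilon>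
  proof -
    obtain K where K: "\<forall>\<^sub>F b in at_top. exp (- ((1 + \<epsilon>)\<^sup>2 * \<rho> * b + K)) \<le> pr b"
      using rare_event_lower_bound[OF A \<beta> Q[OF bp(1)] \<epsilon>] unfolding \<rho>_eq pr_def .
    then have "\<forall>\<^sub>F b in at_top. pr b > 0 \<and> - ln (pr b) \<le> (1 + \<epsilon>)\<^sup>2 * \<rho> * b + K"
    proof eventually_elim
      case (elim b)
      have pos: "pr b > 0" by (rule less_le_trans[OF exp_gt_zero elim])
      then have "- ((1 + \<epsilon>)\<^sup>2 * \<rho> * b + K) \<le> ln (pr b)" using elim by (simp add: ln_ge_iff)
      then show ?case using pos by linarith
    qed
    then show ?thesis by blast
  qed
  have large: "\<forall>\<^sub>F b in at_top. b > 0 \<and> d < c * b" if "c > 0" for c d :: real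
    using eventually_gt_at_top[of "d / c"] eventually_gt_at_top[of 0]
    by eventually_elim (use that in \<open>simp add: pos_divide_less_eq mult.commute\<close>)
  \<comment> \<open>Combining both estimates gives
    \<open>2 * ln (pr b) \<le> ln C - 2 * \<rho> * b\<close>, so the denominator is eventually
    negative and division reverses inequalities.\<close>
  have neg: "\<forall>\<^sub>F b in at_top. b > 0 \<and> pr b > 0 \<and> ln (pr b) < 0"
  proof -
    obtain K where "\<forall>\<^sub>F b in at_top. pr b > 0 \<and> - ln (pr b) \<le> (1 + 1)\<^sup>2 * \<rho> * b + K"
      using lower[of 1] by auto
    moreover have "\<forall>\<^sub>F b in at_top. b > 0 \<and> ln C < (2 * \<rho>) * b" using \<rho>_pos by (intro large) simp
    ultimately show ?thesis
    proof eventually_elim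
      case (elim b)
      then have "pr b > 0" "b > 0" by auto
      then show ?case using upper[of b] jensen[of b] elim by linarith
    qed
  qed
  have "((\<lambda>b. ln (m2 b) / (2 * ln (pr b))) \<longlongrightarrow> 1) at_top"
  proof (rule order_tendstoI)
    fix a :: real assume "1 < a"
    show "\<forall>\<^sub>F b in at_top. ln (m2 b) / (2 * ln (pr b)) < a"
      using neg
    proof eventually_elim
      case (elim b)
      then have "ln (m2 b) / (2 * ln (pr b)) \<le> 1"
        using jensen[of b] by (subst neg_divide_le_eq) auto
      then show ?case using \<open>1 < a\<close> by linarith
    qed
  next
    fix a' :: real assume "a' < 1"
    \<comment> \<open>Raising the threshold to a nonnegative number allows the bound on
      \<open>- ln (pr b)\<close> to be multiplied by it.\<close>
    define a where "a = max a' 0"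
    have a: "0 \<le> a" "a < 1" "a' \<le> a" using \<open>a' < 1\<close> by (auto simp: a_def)
    have "((\<lambda>\<epsilon>. a * (1 + \<epsilon>)\<^sup>2) \<longlongrightarrow> a * (1 + 0)\<^sup>2) (at_right 0)" by (intro tendsto_intros)
    then have "\<forall>\<^sub>F \<epsilon> in at_right 0. a * (1 + \<epsilon>)\<^sup>2 < 1" using a(2) by (intro order_tendstoD(2)) auto
    then have "\<forall>\<^sub>F \<epsilon> in at_right 0. a * (1 + \<epsilon>)\<^sup>2 < 1 \<and> \<epsilon> > 0"
      using eventually_at_right_less[of 0] by eventually_elim simp
    then obtain \<epsilon> where \<epsilon>: "a * (1 + \<epsilon>)\<^sup>2 < 1" "\<epsilon> > 0"
      using eventually_happens[of _ "at_right (0::real)"] by auto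
    obtain K where K: "\<forall>\<^sub>F b in at_top. pr b > 0 \<and> - ln (pr b) \<le> (1 + \<epsilon>)\<^sup>2 * \<rho> * b + K"
      using lower[OF \<epsilon>(2)] by auto
    \<comment> \<open>The choice of \<epsilon> leaves a positive linear gap, which eventually
      exceeds the constants \<open>ln C\<close> and \<open>K\<close>.\<close>
    have "\<forall>\<^sub>F b in at_top. b > 0 \<and> ln C + 2 * a * K < (2 * \<rho> * (1 - a * (1 + \<epsilon>)\<^sup>2)) * b"
      using \<epsilon>(1) \<rho>_pos by (intro large mult_pos_pos) auto
    then show "\<forall>\<^sub>F b in at_top. a' < ln (m2 b) / (2 * ln (pr b))"
      using K neg
    proof eventually_elim
      case (elim b)
      have "a * (- ln (pr b)) \<le> a * ((1 + \<epsilon>)\<^sup>2 * \<rho> * b + K)"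
        using elim a(1) by (intro mult_left_mono) auto
      then have "2 * (a * (- ln (pr b))) \<le> 2 * (a * ((1 + \<epsilon>)\<^sup>2 * \<rho> * b + K))" by linarith
      also have "\<dots> < 2 * \<rho> * b - ln C"
        using elim by (simp add: algebra_simps)
      also have "\<dots> \<le> - ln (m2 b)" using upper[of b] elim by linarith
      finally have "ln (m2 b) < a * (2 * ln (pr b))" by linarith
      then have "a < ln (m2 b) / (2 * ln (pr b))"
        using elim by (simp add: neg_less_divide_eq)
      then show ?case using a(3) by linarith
    qed
  qed
  moreover have "\<forall>\<^sub>F b in at_top. integrable (mixture Q \<Theta>) (\<lambda>\<omega>. (W_hat b \<Theta> \<omega>)\<^sup>2)"
    using eventually_gt_at_top[of 0] by eventually_elim (rule moments(1))
  ultimately show ?thesis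
    by (simp add: asymptotically_efficient_def m2_def pr_def rare_event_def)
qed

end

section \<open>The pairs of vectors supplied by (H1) and (H2)\<close>

lemma s_eq:
  assumes "is_gamma m m' \<gamma>"
  shows "s m m' = ereal (u * (\<gamma> $ m + \<gamma> $ m'))"
  unfolding s_def
proof (rule antisym)
  show "(SUP \<theta>\<in>feasible m m'. ereal (u * (\<theta> $ m + \<theta> $ m'))) \<le> ereal (u * (\<gamma> $ m + \<gamma> $ m'))"
    using assms by (intro SUP_least) (auto simp: is_gamma_def is_arg_max_linorder)
  show "ereal (u * (\<gamma> $ m + \<gamma> $ m')) \<le> (SUP \<theta>\<in>feasible m m'. ereal (u * (\<theta> $ m + \<theta> $ m')))"
    using assms by (intro SUP_upper) (auto simp: is_gamma_def is_arg_max_def)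
qed

text \<open>The vector is supported on two coordinates of \<open>A\<close>, where it is nonnegative
  and the vertex equals \<open>u\<close>; the sign conditions hold trivially at all other
  coordinates, whichever larger \<open>A\<close> is taken.\<close>

lemma feasible_dual_feasible:
  assumes "\<theta> \<in> feasible m m'" "m \<noteq> m'" "m \<in> A" "m' \<in> A"
  shows "dual_feasible A \<theta>" "\<theta> \<bullet> corner A = u * (\<theta> $ m + \<theta> $ m')"
proof -
  have zero: "\<theta> $ k = 0" if "k \<notin> {m, m'}" for k using assms(1) that by (auto simp: feasible_def)
  have "orient A k * \<theta> $ k \<ge> 0" for k
    using assms zero[of k] by (cases "k \<in> {m, m'}") (auto simp: feasible_def orient_def)
  then show "dual_feasible A \<theta>" using assms(1) by (simp add: dual_feasible_def feasible_def)
  have "\<theta> \<bullet> corner A = (\<Sum>k\<in>{m, m'}. \<theta> $ k * corner A $ k)"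
    unfolding inner_vec_def inner_real_def using zero by (intro sum.mono_neutral_right) auto
  then show "\<theta> \<bullet> corner A = u * (\<theta> $ m + \<theta> $ m')"
    using assms(2-4) by (simp add: corner_def algebra_simps)
qed

lemma is_z_feasible:
  assumes "is_z k z"
  shows "axis k z \<in> feasible k k'"
  using assms by (auto simp: feasible_def is_z_def Lambda_le_0_iff edom_iff mgf_def inner_axis' axis_nth_if)

lemma beta_dual_feasible: "is_beta A \<beta> \<Longrightarrow> dual_feasible A \<beta>"
  using beta_properties[of A \<beta>] by (simp add: dual_feasible_def Lambda_le_0_iff)

text \<open>The index type is finite, so the infima are attained, at a common index.\<close>

lemma singleton_minimum:
  "\<exists>k0. (\<forall>k. r {k0} \<le> r {k}) \<and> (INF k. r {k}) = r {k0} \<and> (INF k. 2 * r {k}) = 2 * r {k0}"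
proof -
  have "Min (range (\<lambda>k. r {k})) \<in> range (\<lambda>k. r {k})" by (intro Min_in) auto
  then obtain k0 where "Min (range (\<lambda>k. r {k})) = r {k0}" by (rule rangeE)
  then have le: "r {k0} \<le> r {k}" for k
    using Min_le[of "range (\<lambda>k. r {k})" "r {k}"] by simp
  moreover have "(INF k. r {k}) = r {k0}"
    by (intro antisym INF_lower INF_greatest le) simp
  moreover have "(INF k. 2 * r {k}) = 2 * r {k0}"
    by (intro antisym INF_lower INF_greatest ereal_mult_left_mono le) simp_all
  ultimately show ?thesis by blast
qed

text \<open>A nonempty set is a singleton, served by one vector used twice, or contains two distinct
  indices.\<close>

lemma coversI:
  assumes single: "\<And>k. \<exists>\<theta>\<in>\<Theta>. dual_feasible {k} \<theta> \<and> \<rho> \<le> \<theta> \<bullet> corner {k}"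
    and pair: "\<And>k k' A. k \<noteq> k' \<Longrightarrow> k \<in> A \<Longrightarrow> k' \<in> A \<Longrightarrow>
      \<exists>\<theta> \<eta>. \<theta> \<in> \<Theta> \<and> dual_feasible A \<theta> \<and> dual_feasible A \<eta> \<and> 2 * \<rho> \<le> \<theta> \<bullet> corner A + \<eta> \<bullet> corner A"
  shows "covers \<Theta> \<rho>"
  unfolding covers_def
proof (intro allI impI)
  fix A :: "'d set" assume "A \<noteq> {}"
  then obtain k where k: "k \<in> A" by auto
  show "\<exists>\<theta> \<eta>. \<theta> \<in> \<Theta> \<and> dual_feasible A \<theta> \<and> dual_feasible A \<eta> \<and> 2 * \<rho> \<le> \<theta> \<bullet> corner A + \<eta> \<bullet> corner A"
  proof (cases "A = {k}")
    case True
    obtain \<theta> where "\<theta> \<in> \<Theta>" "dual_feasible {k} \<theta>" "\<rho> \<le> \<theta> \<bullet> corner {k}" using single by blast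
    then show ?thesis unfolding True by (intro exI[of _ \<theta>]) auto
  next
    case False
    then obtain k' where "k' \<in> A" "k \<noteq> k'" using k by auto
    then show ?thesis using k by (intro pair[of k k'])
  qed
qed

context
  fixes Q :: "real ^ 'd \<Rightarrow> 'a measure"
    and \<beta> :: "'d set \<Rightarrow> real ^ 'd" and z :: "'d \<Rightarrow> real" and \<gamma> :: "'d \<Rightarrow> 'd \<Rightarrow> real ^ 'd"
  assumes Q: "\<And>\<theta>. \<theta> \<in> edom Lambda \<Longrightarrow> is_tilted \<theta> (Q \<theta>)"
    and \<beta>: "\<And>A. A \<noteq> {} \<Longrightarrow> is_beta A (\<beta> A)"
    and z: "\<And>k. is_z k (z k)"
    and \<gamma>: "\<And>k k'. k \<noteq> k' \<Longrightarrow> is_gamma k k' (\<gamma> k k')"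
begin

lemma gamma_feasible: "k \<noteq> k' \<Longrightarrow> \<gamma> k k' \<in> feasible k k'"
  using \<gamma> by (auto simp: is_gamma_def is_arg_max_def)

lemma single_cover:
  assumes "\<And>k. ereal \<rho> \<le> r {k}"
  shows "dual_feasible {k} (\<beta> {k})" "\<rho> \<le> \<beta> {k} \<bullet> corner {k}"
  using assms[of k] beta_properties(4)[OF \<beta>, of "{k}"] beta_dual_feasible[OF \<beta>, of "{k}"] by auto

text \<open>For distinct \<open>k\<close>, \<open>k'\<close> in \<open>A\<close> the pair consists
  of \<open>axis k (z k)\<close> from the family and \<open>\<gamma> k k'\<close>; their values at
  the vertex add up to the left-hand side of (H1) for this pair of indices.\<close>

lemma H1_covers:
  assumes H1: "H1 z" and \<rho>: "\<And>k. ereal \<rho> \<le> r {k}" "(INF k. 2 * r {k}) = ereal (2 * \<rho>)"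
  shows "covers ({\<beta> {k} |k. True} \<union> {axis k (z k) |k. True}) \<rho>"
proof (rule coversI)
  show "\<exists>\<theta>\<in>{\<beta> {k} |k. True} \<union> {axis k (z k) |k. True}. dual_feasible {k} \<theta> \<and> \<rho> \<le> \<theta> \<bullet> corner {k}" for k
    using single_cover[OF \<rho>(1), of k] by blast
next
  fix k k' :: 'd and A assume k: "k \<noteq> k'" "k \<in> A" "k' \<in> A"
  have "ereal (2 * \<rho>) \<le> (INF (k, k')\<in>{(k, k'). k \<noteq> k'}. ereal (u * z k) + s k k')"
    using H1 \<rho>(2) by (simp add: H1_def)
  also have "\<dots> \<le> ereal (u * z k) + s k k'"
    using k(1) by (intro INF_lower2[of "(k, k')"]) auto
  finally have "2 * \<rho> \<le> axis k (z k) \<bullet> corner A + \<gamma> k k' \<bullet> corner A"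
    using feasible_dual_feasible(2)[OF is_z_feasible[OF z] k] feasible_dual_feasible(2)[OF gamma_feasible k]
      s_eq[OF \<gamma>] k(1) by (simp add: axis_def)
  then show "\<exists>\<theta> \<eta>. \<theta> \<in> {\<beta> {k} |k. True} \<union> {axis k (z k) |k. True} \<and>
      dual_feasible A \<theta> \<and> dual_feasible A \<eta> \<and> 2 * \<rho> \<le> \<theta> \<bullet> corner A + \<eta> \<bullet> corner A"
    using feasible_dual_feasible(1)[OF is_z_feasible[OF z] k] feasible_dual_feasible(1)[OF gamma_feasible k] k(1)
    by blast
qed

text \<open>Here \<open>\<gamma> k k'\<close> belongs to the family and serves as both vectors, with
  total value \<open>2 * s k k'\<close>.\<close>

lemma H2_covers:
  assumes H2: H2 and \<rho>: "\<And>k. ereal \<rho> \<le> r {k}" "(INF k. 2 * r {k}) = ereal (2 * \<rho>)"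
  shows "covers ({\<beta> {k} |k. True} \<union> {\<gamma> k k' |k k'. k \<noteq> k'}) \<rho>"
proof (rule coversI)
  show "\<exists>\<theta>\<in>{\<beta> {k} |k. True} \<union> {\<gamma> k k' |k k'. k \<noteq> k'}. dual_feasible {k} \<theta> \<and> \<rho> \<le> \<theta> \<bullet> corner {k}" for k
    using single_cover[OF \<rho>(1), of k] by blast
next
  fix k k' :: 'd and A assume k: "k \<noteq> k'" "k \<in> A" "k' \<in> A"
  have "ereal (2 * \<rho>) \<le> (INF (k, k')\<in>{(k, k'). k \<noteq> k'}. 2 * s k k')"
    using H2 \<rho>(2) by (simp add: H2_def)
  also have "\<dots> \<le> 2 * s k k'"
    using k(1) by (intro INF_lower2[of "(k, k')"]) auto
  finally have "2 * \<rho> \<le> \<gamma> k k' \<bullet> corner A + \<gamma> k k' \<bullet> corner A"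
    using feasible_dual_feasible(2)[OF gamma_feasible k] s_eq[OF \<gamma>] k(1) by (simp add: numeral_eq_ereal)
  then show "\<exists>\<theta> \<eta>. \<theta> \<in> {\<beta> {k} |k. True} \<union> {\<gamma> k k' |k k'. k \<noteq> k'} \<and>
      dual_feasible A \<theta> \<and> dual_feasible A \<eta> \<and> 2 * \<rho> \<le> \<theta> \<bullet> corner A + \<eta> \<bullet> corner A"
    using feasible_dual_feasible(1)[OF gamma_feasible k] k(1) by blast
qed

lemma efficiency:
  shows "(H1 z \<or> H2 \<longrightarrow> r_star = (INF k. r {k})) \<and>
    (H1 z \<longrightarrow> asymptotically_efficient Q ({\<beta> {k} |k. True} \<union> {axis k (z k) |k. True})) \<and>
    (H2 \<longrightarrow> asymptotically_efficient Q ({\<beta> {k} |k. True} \<union> {\<gamma> k k' |k k'. k \<noteq> k'}))"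
proof -
  obtain k0 where k0: "\<And>k. r {k0} \<le> r {k}" "(INF k. r {k}) = r {k0}" "(INF k. 2 * r {k}) = 2 * r {k0}"
    using singleton_minimum by blast
  \<comment> \<open>The common decay rate is the smallest \<open>r {k}\<close>, attained at
    \<open>k0\<close>. Covering at this level gives \<open>\<rho> \<le> r_star\<close>, and
    \<open>k0\<close> itself gives the converse.\<close>
  define \<rho> where "\<rho> = \<beta> {k0} \<bullet> corner {k0}"
  have \<rho>: "r {k0} = ereal \<rho>" using beta_properties(4)[OF \<beta>, of "{k0}"] by (simp add: \<rho>_def)
  have min: "ereal \<rho> \<le> r {k}" for k using k0(1) by (simp add: \<rho>)
  have INF2: "(INF k. 2 * r {k}) = ereal (2 * \<rho>)" unfolding k0(3) \<rho> by (simp add: numeral_eq_ereal)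
  have "r_star \<le> r {k0}" unfolding r_star_def by (rule INF_lower) simp
  then have star: "r_star = (INF k. r {k})" if "covers \<Theta> \<rho>" for \<Theta>
    using covers_le_r_star[OF that] \<rho> k0(2) by simp
  have \<beta>_dom: "{\<beta> {k} |k. True} \<subseteq> edom Lambda"
    using beta_properties(1)[OF \<beta>] by auto
  have 1: "asymptotically_efficient Q ({\<beta> {k} |k. True} \<union> {axis k (z k) |k. True})" if "H1 z"
  proof (rule covers_imp_asymptotically_efficient[OF Q _ _ H1_covers[OF that min INF2] _ \<beta> \<rho>])
    show "finite ({\<beta> {k} |k. True} \<union> {axis k (z k) |k. True})"
      by (simp add: full_SetCompr_eq)
    show "{\<beta> {k} |k. True} \<union> {axis k (z k) |k. True} \<subseteq> edom Lambda"
      using \<beta>_dom is_z_feasible[OF z] by (auto simp: feasible_def Lambda_le_0_iff)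
  qed auto
  have 2: "asymptotically_efficient Q ({\<beta> {k} |k. True} \<union> {\<gamma> k k' |k k'. k \<noteq> k'})" if H2
  proof (rule covers_imp_asymptotically_efficient[OF Q _ _ H2_covers[OF that min INF2] _ \<beta> \<rho>])
    have "{\<gamma> k k' |k k'. k \<noteq> k'} \<subseteq> range (\<lambda>(k, k'). \<gamma> k k')" by auto
    then have "finite {\<gamma> k k' |k k'. k \<noteq> k'}" by (rule finite_subset) simp
    then show "finite ({\<beta> {k} |k. True} \<union> {\<gamma> k k' |k k'. k \<noteq> k'})"
      by (simp add: full_SetCompr_eq)
    show "{\<beta> {k} |k. True} \<union> {\<gamma> k k' |k k'. k \<noteq> k'} \<subseteq> edom Lambda"
      using \<beta>_dom gamma_feasible by (auto simp: feasible_def Lambda_le_0_iff)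
  qed auto
  show ?thesis
    using star[OF H1_covers[OF _ min INF2]] star[OF H2_covers[OF _ min INF2]] 1 2 by blast
qed

end

end

theorem theorem4p2:
  fixes M :: "'a measure" and X :: "nat \<Rightarrow> 'a \<Rightarrow> real ^ 'd::finite" and l u :: real
    and Q :: "real ^ 'd \<Rightarrow> 'a measure"
    and \<beta> :: "'d set \<Rightarrow> real ^ 'd" and z :: "'d \<Rightarrow> real" and \<gamma> :: "'d \<Rightarrow> 'd \<Rightarrow> real ^ 'd"
  assumes "siegmund M X l u"
    and "\<And>\<theta>. \<theta> \<in> edom (random_walk.Lambda M X) \<Longrightarrow> random_walk.is_tilted M X \<theta> (Q \<theta>)"
    and "\<And>A. A \<noteq> {} \<Longrightarrow> siegmund.is_beta M X l u A (\<beta> A)"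
    and "\<And>k. siegmund.is_z M X k (z k)"
    and "\<And>k k'. k \<noteq> k' \<Longrightarrow> siegmund.is_gamma M X u k k' (\<gamma> k k')"
  shows "(siegmund.H1 M X l u z \<or> siegmund.H2 M X l u \<longrightarrow>
            siegmund.r_star M X l u = (INF k. siegmund.r M X l u {k})) \<and>
         (siegmund.H1 M X l u z \<longrightarrow>
            siegmund.asymptotically_efficient M X l u Q
              ({\<beta> {k} |k. True} \<union> {axis k (z k) |k. True})) \<and>
         (siegmund.H2 M X l u \<longrightarrow>
            siegmund.asymptotically_efficient M X l u Q
              ({\<beta> {k} |k. True} \<union> {\<gamma> k k' |k k'. k \<noteq> k'}))"
proof -
  interpret siegmund M X l u by fact
  show ?thesis using assms(2-5) by (rule efficiency)
qed

end
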